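(* Let $n$, $s$, $k$ be positive integers with $n > s$, and let $c$ be a real number with $$c\geq n^{k-1} + \max\left(k^2 s\, n^{k-\frac 32}\sqrt{8\log(2ks)},\ 8k\,n^{k-1}\log(2ks)\right).$$ Then the sequence $f_1,\dots,f_s$ given by $f_i = (i-1)n^{k-1}+c$ for $i=1,\dots,s$ is satisfying (with respect to $n$, $s$, $k$).
   Context: Let $[n]=\{1,\dots,n\}$. Two tuples $F,G\in[n]^k$ are disjoint if, for each $i\in\{1,\dots,k\}$, the $i$-th coordinate of $F$ is different from the $i$-th coordinate of $G$. Let $n\ge s$ and $k$ be positive integers. A sequence $f_1,\dots,f_s$ is called satisfying if for every list of subsets $\mathcal F_1,\dots,\mathcal F_s\subseteq [n]^k$ with $|\mathcal F_i|>f_i$ for all $i$, there exist pairwise disjoint tuples $F_1\in\mathcal F_1,\dots,F_s\in\mathcal F_s$ (a rainbow matching). Here $\log$ denotes the natural logarithm. *)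

theory Defs
  imports Complex_Main "HOL-Library.FuncSet"
begin

text \<open>A tuple is a function on \<open>{1..k}\<close>, extended by \<^const>\<open>undefined\<close> outside \<open>{1..k}\<close>, so that
  equality of tuples is equality of functions and there are exactly \<open>n ^ k\<close> of them.\<close>

definition tuples :: "nat \<Rightarrow> nat \<Rightarrow> (nat \<Rightarrow> nat) set" where
  "tuples n k = {1..k} \<rightarrow>\<^sub>E {1..n}"

definition disjoint_tuples :: "nat \<Rightarrow> (nat \<Rightarrow> nat) \<Rightarrow> (nat \<Rightarrow> nat) \<Rightarrow> bool" where
  "disjoint_tuples k F G \<longleftrightarrow> (\<forall>i\<in>{1..k}. F i \<noteq> G i)"

text \<open>Only the values \<open>f 1, \<dots>, f s\<close> of \<open>f\<close> matter.\<close>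

definition satisfying :: "nat \<Rightarrow> nat \<Rightarrow> nat \<Rightarrow> (nat \<Rightarrow> real) \<Rightarrow> bool" where
  "satisfying n s k f \<longleftrightarrow>
     (\<forall>\<F> :: nat \<Rightarrow> (nat \<Rightarrow> nat) set.
        (\<forall>i\<in>{1..s}. \<F> i \<subseteq> tuples n k \<and> real (card (\<F> i)) > f i) \<longrightarrow>
        (\<exists>F. (\<forall>i\<in>{1..s}. F i \<in> \<F> i) \<and>
             pairwise (\<lambda>i j. disjoint_tuples k (F i) (F j)) {1..s}))"

end

theory Submission
  imports Defs "HOL-Combinatorics.Permutations"
begin

text \<open>
  Call a value \<open>v\<close> of coordinate \<open>l\<close> heavy for a family if more than \<open>d = (k-1)(s-1)n^(k-2)\<close> of its
  tuples take the value \<open>v\<close> there. A heavy value is as good as a tuple: at most \<open>d\<close> tuples through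
  it meet \<open>s-1\<close> given tuples in some other coordinate, so a family that has reserved a heavy
  value can postpone the choice of its tuple. The tuples without heavy values form the
  light part of the family; every value has degree at most \<open>d\<close> there, so if the light part has
  more than \<open>k(s-1)d\<close> elements, then it offers a tuple whatever the other families have chosen
  (\<open>exists_tuple_avoiding\<close>, \<open>exists_completion\<close>).

  For the remaining families take a random perfect matching of the grid: permutations
  \<open>\<sigma> 1, \<dots>, \<sigma> k\<close> of \<open>{1..n}\<close>, whose row \<open>r\<close> is the tuple \<open>(\<sigma> 1 r, \<dots>, \<sigma> k r)\<close>. A row is usable for
  a family if it contains one of its heavy values or belongs to its light part. If the \<open>i\<close>-th
  family has at least \<open>i\<close> usable rows for every \<open>i\<close>, then distinct usable rows can be picked in
  increasing order of \<open>i\<close>, and the values they provide are disjoint, because rows of a perfect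
  matching are (\<open>rainbow_matching_of_usable\<close>).

  The expected number of usable rows is at least \<open>|F i| / n^(k-1) > i - 1 + c / n^(k-1)\<close>, so only
  the lower tail has to be controlled. Treating the two kinds of usable rows separately is what
  makes the given \<open>c\<close> sufficient. The number of rows with a heavy value fluctuates only through
  coincidences of heavy values in different coordinates, of which about \<open>k^2 s^2 / n\<close> are
  expected (a coordinate with more than \<open>s\<close> heavy values makes more than \<open>s\<close> rows usable with
  certainty). The number of rows in the light part behaves like a Poisson variable,
  but its mean is at most \<open>k(s-1)d / n^(k-1)\<close>, hence at most \<open>k(k-1) s^2 / n\<close>, because larger
  light parts were set aside. Both standard deviations are of order \<open>s / sqrt n\<close> for fixed \<open>k\<close>,
  and the exponential moment bounds leave a failure probability below \<open>1 / (2 k s)\<close>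
  for each of the at most \<open>2 s\<close> events.

  The moment bounds come from one inequality for \<open>\<Sum>r. a r (\<pi> r)\<close> with a random permutation \<open>\<pi>\<close> and
  entries in \<open>[0,1]\<close> (\<open>perm_mean_exp_le\<close>). The permutations \<open>\<sigma> 1, \<dots>, \<sigma> k\<close> are fixed one
  after the other, each chosen so that a sum of exponentials, which bounds the conditional
  probability of failure, does not increase (\<open>exists_permutations_potential_le\<close>).
\<close>

section \<open>Exponential moments of sums along a random permutation\<close>

definition perm_mean :: "'a set \<Rightarrow> (('a \<Rightarrow> 'a) \<Rightarrow> real) \<Rightarrow> real" where
  "perm_mean A f = (\<Sum>\<pi> | \<pi> permutes A. f \<pi>) / real (card {\<pi>. \<pi> permutes A})"

lemma card_permutes_pos:
  assumes "finite A"
  shows "0 < real (card {\<pi>. \<pi> permutes A})"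
proof -
  have "id \<in> {\<pi>. \<pi> permutes A}" by (simp add: permutes_id)
  then have "card {\<pi>. \<pi> permutes A} \<noteq> 0"
    using finite_permutations[OF assms] by (metis card_0_eq empty_iff)
  then show ?thesis by simp
qed

lemma perm_mean_add: "perm_mean A (\<lambda>\<pi>. f \<pi> + g \<pi>) = perm_mean A f + perm_mean A g"
  by (simp add: perm_mean_def sum.distrib add_divide_distrib)

lemma perm_mean_sum: "perm_mean A (\<lambda>\<pi>. \<Sum>i\<in>I. f i \<pi>) = (\<Sum>i\<in>I. perm_mean A (f i))"
  unfolding perm_mean_def sum_divide_distrib by (rule sum.swap)

lemma perm_mean_mult_left: "perm_mean A (\<lambda>\<pi>. c * f \<pi>) = c * perm_mean A f"
  by (simp add: perm_mean_def sum_distrib_left)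

lemma perm_mean_mono:
  assumes "\<And>\<pi>. \<pi> permutes A \<Longrightarrow> f \<pi> \<le> g \<pi>"
  shows "perm_mean A f \<le> perm_mean A g"
  unfolding perm_mean_def using assms by (intro divide_right_mono sum_mono) auto

lemma exists_le_perm_mean:
  assumes "finite A"
  obtains \<pi> where "\<pi> permutes A" and "f \<pi> \<le> perm_mean A f"
proof -
  have "\<exists>\<pi>. \<pi> permutes A \<and> f \<pi> \<le> perm_mean A f"
  proof (rule ccontr)
    assume "\<not> ?thesis"
    then have less: "perm_mean A f < f \<pi>" if "\<pi> \<in> {\<pi>. \<pi> permutes A}" for \<pi>
      using that by (auto simp: not_le)
    have "id \<in> {\<pi>. \<pi> permutes A}" by (simp add: permutes_id)
    then have "(\<Sum>\<pi> | \<pi> permutes A. perm_mean A f) < (\<Sum>\<pi> | \<pi> permutes A. f \<pi>)"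
      by (intro sum_strict_mono finite_permutations assms less) blast+
    then show False
      using card_permutes_pos[OF assms] by (simp add: perm_mean_def)
  qed
  then show thesis using that by blast
qed

text \<open>
  The trapezoidal rule overestimates the integral of a convex function. The cruder bound with the
  maximum of the two exponentials would double the error term of the moment bound below, which
  would be too much for the constant 8 in the theorem when \<open>k\<close> is small.
\<close>

lemma abs_exp_diff_le_trapezoid:
  fixes u v :: real
  shows "\<bar>exp u - exp v\<bar> \<le> \<bar>u - v\<bar> * ((exp u + exp v) / 2)"
proof -
  have nonneg: "exp d - 1 \<le> d * ((exp d + 1) / 2)" if "0 \<le> d" for d :: real
  proof -
    let ?f = "\<lambda>d::real. d * ((exp d + 1) / 2) - (exp d - 1)"
    have "?f 0 \<le> ?f d"
    proof (rule DERIV_nonneg_imp_nondecreasing[where f = ?f, OF that])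
      fix y :: real
      have "1 - y \<le> exp (- y)" using exp_ge_add_one_self[of "- y"] by simp
      then have "(1 - y) * exp y \<le> exp (- y) * exp y" by (intro mult_right_mono) auto
      then have "0 \<le> (1 + y * exp y - exp y) / 2"
        by (simp add: exp_minus algebra_simps)
      moreover have "(?f has_real_derivative (1 + y * exp y - exp y) / 2) (at y)"
        by (auto intro!: derivative_eq_intros simp: field_simps)
      ultimately show "\<exists>z. (?f has_real_derivative z) (at y) \<and> 0 \<le> z" by blast
    qed
    then show ?thesis by simp
  qed
  have ordered: "exp p - exp q \<le> (p - q) * ((exp p + exp q) / 2)" if "q \<le> p" for p q :: real
  proof -
    have "exp q * (exp (p - q) - 1) \<le> exp q * ((p - q) * ((exp (p - q) + 1) / 2))"
      using nonneg[of "p - q"] that by (intro mult_left_mono) auto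
    moreover have "exp q * exp (p - q) = exp p" by (simp flip: exp_add)
    ultimately show ?thesis by (simp add: algebra_simps)
  qed
  show ?thesis
  proof (cases "v \<le> u")
    case True
    then show ?thesis using ordered[of v u] by simp
  next
    case False
    then show ?thesis using ordered[of u v] by (simp add: add.commute)
  qed
qed

lemma sum_permutation_transpose_diff:
  fixes a :: "'a \<Rightarrow> 'a \<Rightarrow> real"
  assumes "finite A" and "i \<in> A" and "j \<in> A"
  shows "(\<Sum>r\<in>A. a r (\<pi> r)) - (\<Sum>r\<in>A. a r ((\<pi> \<circ> transpose i j) r)) =
    (a i (\<pi> i) + a j (\<pi> j)) - (a i (\<pi> j) + a j (\<pi> i))"
proof (cases "i = j")
  case True
  then show ?thesis by simp
next
  case False
  have split: "(\<Sum>r\<in>A. f r) = f i + f j + (\<Sum>r\<in>A - {i, j}. f r)" for f :: "'a \<Rightarrow> real"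
  proof -
    have "(\<Sum>r\<in>A. f r) = (\<Sum>r\<in>{i, j}. f r) + (\<Sum>r\<in>A - {i, j}. f r)"
      using assms by (metis add.commute empty_subsetI insert_subset sum.subset_diff)
    then show ?thesis using False by simp
  qed
  have "(\<Sum>r\<in>A - {i, j}. a r ((\<pi> \<circ> transpose i j) r)) = (\<Sum>r\<in>A - {i, j}. a r (\<pi> r))"
    by (intro sum.cong) (auto simp: transpose_def)
  then show ?thesis
    unfolding split[of "\<lambda>r. a r (\<pi> r)"] split[of "\<lambda>r. a r ((\<pi> \<circ> transpose i j) r)"] by simp
qed

text \<open>
  Chatterjee's exchangeable pair argument. Composing a uniform \<open>\<pi>\<close> with the transposition of two
  independent uniform points \<open>i, j\<close> gives an equally distributed permutation, whose sum \<open>X'\<close>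
  satisfies \<open>E(X - X' | \<pi>) = 2(X - \<mu>)/n\<close>. Exchanging the two permutations turns
  \<open>E((X - X') e^(\<theta>X))\<close> into half of \<open>E((X - X')(e^(\<theta>X) - e^(\<theta>X')))\<close>, which is of second order
  in \<open>X - X'\<close>; since the entries lie in \<open>[0,1]\<close>, \<open>(X - X')^2\<close> is at most twice the sum of the
  four entries involved, whose conditional mean is \<open>2(X + \<mu>)/n\<close>. In the proof \<open>\<tau> \<pi> i j\<close> is the
  transposed permutation, and \<open>p\<close> and \<open>q\<close> collect the entries before and after.
\<close>

lemma abs_exp_moment_centred_le:
  fixes a :: "'a \<Rightarrow> 'a \<Rightarrow> real" and \<theta> :: real
  assumes fin: "finite A" and ne: "A \<noteq> {}"
    and a01: "\<And>r w. r \<in> A \<Longrightarrow> w \<in> A \<Longrightarrow> 0 \<le> a r w \<and> a r w \<le> 1"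
  defines "X \<equiv> \<lambda>\<pi>. \<Sum>r\<in>A. a r (\<pi> r)"
    and "\<mu> \<equiv> (\<Sum>r\<in>A. \<Sum>w\<in>A. a r w) / real (card A)"
  shows "\<bar>\<Sum>\<pi> | \<pi> permutes A. (X \<pi> - \<mu>) * exp (\<theta> * X \<pi>)\<bar> \<le>
    \<bar>\<theta>\<bar> * (\<Sum>\<pi> | \<pi> permutes A. (X \<pi> + \<mu>) * exp (\<theta> * X \<pi>))"
proof -
  let ?P = "{\<pi>. \<pi> permutes A}" and ?n = "real (card A)"
  define \<tau> where "\<tau> \<pi> i j = \<pi> \<circ> transpose i j" for \<pi> :: "'a \<Rightarrow> 'a" and i j
  define E where "E \<pi> = exp (\<theta> * X \<pi>)" for \<pi>
  define p where "p \<pi> i j = a i (\<pi> i) + a j (\<pi> j)" for \<pi> i j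
  define q where "q \<pi> i j = a i (\<pi> j) + a j (\<pi> i)" for \<pi> i j
  have npos: "0 < ?n" using fin ne by (simp add: card_gt_0_iff)
  have nmu: "?n * \<mu> = (\<Sum>r\<in>A. \<Sum>w\<in>A. a r w)" using npos by (simp add: \<mu>_def)
  have diff: "X \<pi> - X (\<tau> \<pi> i j) = p \<pi> i j - q \<pi> i j" if "i \<in> A" "j \<in> A" for \<pi> i j
    using sum_permutation_transpose_diff[OF fin that, of a \<pi>]
    by (simp add: X_def p_def q_def \<tau>_def)
  have sum_p: "(\<Sum>i\<in>A. \<Sum>j\<in>A. p \<pi> i j) = 2 * ?n * X \<pi>" for \<pi>
    by (simp add: p_def sum.distrib X_def sum_distrib_left mult.assoc)
  have sum_q: "(\<Sum>i\<in>A. \<Sum>j\<in>A. q \<pi> i j) = 2 * ?n * \<mu>" if "\<pi> \<in> ?P" for \<pi>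
  proof -
    have perm: "\<pi> permutes A" using that by simp
    have row: "(\<Sum>j\<in>A. a i (\<pi> j)) = (\<Sum>w\<in>A. a i w)" for i
      using sum.permute[OF perm, of "a i"] by (simp add: o_def)
    have "(\<Sum>i\<in>A. \<Sum>j\<in>A. q \<pi> i j) = (\<Sum>i\<in>A. \<Sum>j\<in>A. a i (\<pi> j)) + (\<Sum>i\<in>A. \<Sum>j\<in>A. a j (\<pi> i))"
      by (simp add: q_def sum.distrib)
    also have "(\<Sum>i\<in>A. \<Sum>j\<in>A. a j (\<pi> i)) = (\<Sum>j\<in>A. \<Sum>i\<in>A. a j (\<pi> i))" by (rule sum.swap)
    finally show ?thesis by (simp add: row nmu mult.assoc)
  qed
  have inv: "\<tau> (\<tau> \<pi> i j) i j = \<pi>" for \<pi> i j by (simp add: \<tau>_def comp_assoc)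
  have swap: "(\<Sum>\<pi>\<in>?P. f (\<tau> \<pi> i j)) = (\<Sum>\<pi>\<in>?P. f \<pi>)" if "i \<in> A" "j \<in> A"
    for f :: "('a \<Rightarrow> 'a) \<Rightarrow> real" and i j
  proof -
    have "\<tau> \<pi> i j \<in> ?P" if "\<pi> \<in> ?P" for \<pi>
      using that \<open>i \<in> A\<close> \<open>j \<in> A\<close> by (simp add: \<tau>_def permutes_compose permutes_swap_id)
    then show ?thesis
      by (intro sum.reindex_bij_witness[where i = "\<lambda>\<pi>. \<tau> \<pi> i j" and j = "\<lambda>\<pi>. \<tau> \<pi> i j"]) (auto simp: inv)
  qed
  have pair: "\<bar>\<Sum>\<pi>\<in>?P. (X \<pi> - X (\<tau> \<pi> i j)) * E \<pi>\<bar> \<le> \<bar>\<theta>\<bar> * (\<Sum>\<pi>\<in>?P. (p \<pi> i j + q \<pi> i j) * E \<pi>)"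
    if ij: "i \<in> A" "j \<in> A" for i j
  proof -
    let ?d = "\<lambda>\<pi>. X \<pi> - X (\<tau> \<pi> i j)"
    have "(\<Sum>\<pi>\<in>?P. ?d \<pi> * E (\<tau> \<pi> i j)) = (\<Sum>\<pi>\<in>?P. (X (\<tau> \<pi> i j) - X \<pi>) * E \<pi>)"
      using swap[OF ij, of "\<lambda>\<pi>. (X (\<tau> \<pi> i j) - X \<pi>) * E \<pi>"] by (simp add: inv)
    also have "\<dots> = - (\<Sum>\<pi>\<in>?P. ?d \<pi> * E \<pi>)"
      by (simp flip: sum_negf add: algebra_simps)
    finally have "2 * (\<Sum>\<pi>\<in>?P. ?d \<pi> * E \<pi>) = (\<Sum>\<pi>\<in>?P. ?d \<pi> * (E \<pi> - E (\<tau> \<pi> i j)))"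
      by (simp add: right_diff_distrib sum_subtractf)
    then have "2 * \<bar>\<Sum>\<pi>\<in>?P. ?d \<pi> * E \<pi>\<bar> = \<bar>\<Sum>\<pi>\<in>?P. ?d \<pi> * (E \<pi> - E (\<tau> \<pi> i j))\<bar>"
      by simp
    also have "\<dots> \<le> (\<Sum>\<pi>\<in>?P. \<bar>?d \<pi> * (E \<pi> - E (\<tau> \<pi> i j))\<bar>)" by (rule sum_abs)
    also have "\<dots> \<le> (\<Sum>\<pi>\<in>?P. \<bar>\<theta>\<bar> * ((?d \<pi>)\<^sup>2 * E \<pi> + (?d \<pi>)\<^sup>2 * E (\<tau> \<pi> i j)) / 2)"
    proof (rule sum_mono)
      fix \<pi>
      have "\<bar>E \<pi> - E (\<tau> \<pi> i j)\<bar> \<le> \<bar>\<theta> * ?d \<pi>\<bar> * ((E \<pi> + E (\<tau> \<pi> i j)) / 2)"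
        unfolding E_def using abs_exp_diff_le_trapezoid[of "\<theta> * X \<pi>" "\<theta> * X (\<tau> \<pi> i j)"]
        by (simp add: right_diff_distrib)
      then have "\<bar>?d \<pi>\<bar> * \<bar>E \<pi> - E (\<tau> \<pi> i j)\<bar> \<le> \<bar>?d \<pi>\<bar> * (\<bar>\<theta> * ?d \<pi>\<bar> * ((E \<pi> + E (\<tau> \<pi> i j)) / 2))"
        by (intro mult_left_mono) auto
      also have "\<dots> = \<bar>\<theta>\<bar> * (\<bar>?d \<pi>\<bar> * \<bar>?d \<pi>\<bar>) * ((E \<pi> + E (\<tau> \<pi> i j)) / 2)"
        by (simp add: abs_mult)
      also have "\<bar>?d \<pi>\<bar> * \<bar>?d \<pi>\<bar> = (?d \<pi>)\<^sup>2" by (simp add: power2_eq_square)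
      finally show "\<bar>?d \<pi> * (E \<pi> - E (\<tau> \<pi> i j))\<bar> \<le>
          \<bar>\<theta>\<bar> * ((?d \<pi>)\<^sup>2 * E \<pi> + (?d \<pi>)\<^sup>2 * E (\<tau> \<pi> i j)) / 2"
        unfolding abs_mult by (simp add: algebra_simps)
    qed
    also have "\<dots> = \<bar>\<theta>\<bar> * ((\<Sum>\<pi>\<in>?P. (?d \<pi>)\<^sup>2 * E \<pi>) + (\<Sum>\<pi>\<in>?P. (?d \<pi>)\<^sup>2 * E (\<tau> \<pi> i j))) / 2"
      by (simp add: sum_divide_distrib sum_distrib_left flip: sum.distrib)
    also have "(\<Sum>\<pi>\<in>?P. (?d \<pi>)\<^sup>2 * E (\<tau> \<pi> i j)) = (\<Sum>\<pi>\<in>?P. (?d \<pi>)\<^sup>2 * E \<pi>)"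
      using swap[OF ij, of "\<lambda>\<pi>. (?d \<pi>)\<^sup>2 * E \<pi>"] by (simp add: inv power2_commute)
    finally have "2 * \<bar>\<Sum>\<pi>\<in>?P. ?d \<pi> * E \<pi>\<bar> \<le> \<bar>\<theta>\<bar> * (\<Sum>\<pi>\<in>?P. (?d \<pi>)\<^sup>2 * E \<pi>)" by simp
    also have "\<dots> \<le> \<bar>\<theta>\<bar> * (\<Sum>\<pi>\<in>?P. 2 * ((p \<pi> i j + q \<pi> i j) * E \<pi>))"
    proof (intro mult_left_mono sum_mono)
      fix \<pi> assume "\<pi> \<in> ?P"
      then have "\<pi> i \<in> A" "\<pi> j \<in> A" using ij by (auto simp: permutes_in_image)
      then have pq: "0 \<le> p \<pi> i j" "p \<pi> i j \<le> 2" "0 \<le> q \<pi> i j" "q \<pi> i j \<le> 2"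
        using a01[of i "\<pi> i"] a01[of i "\<pi> j"] a01[of j "\<pi> i"] a01[of j "\<pi> j"] ij
        by (auto simp: p_def q_def)
      have "(?d \<pi>)\<^sup>2 = \<bar>p \<pi> i j - q \<pi> i j\<bar> * \<bar>p \<pi> i j - q \<pi> i j\<bar>"
        using diff[OF ij] by (simp add: power2_eq_square)
      also have "\<dots> \<le> 2 * (p \<pi> i j + q \<pi> i j)"
        using pq by (intro mult_mono) auto
      finally have "(?d \<pi>)\<^sup>2 * E \<pi> \<le> 2 * (p \<pi> i j + q \<pi> i j) * E \<pi>"
        by (intro mult_right_mono) (auto simp: E_def)
      then show "(?d \<pi>)\<^sup>2 * E \<pi> \<le> 2 * ((p \<pi> i j + q \<pi> i j) * E \<pi>)" by (simp only: mult.assoc)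
    qed simp
    finally show ?thesis by (simp flip: sum_distrib_left)
  qed
  have lhs: "(\<Sum>i\<in>A. \<Sum>j\<in>A. \<Sum>\<pi>\<in>?P. (X \<pi> - X (\<tau> \<pi> i j)) * E \<pi>) =
      2 * ?n * (\<Sum>\<pi>\<in>?P. (X \<pi> - \<mu>) * E \<pi>)"
  proof -
    have "(\<Sum>i\<in>A. \<Sum>j\<in>A. \<Sum>\<pi>\<in>?P. (X \<pi> - X (\<tau> \<pi> i j)) * E \<pi>) =
        (\<Sum>i\<in>A. \<Sum>j\<in>A. \<Sum>\<pi>\<in>?P. (p \<pi> i j - q \<pi> i j) * E \<pi>)"
      by (intro sum.cong refl) (simp add: diff)
    also have "\<dots> = (\<Sum>\<pi>\<in>?P. \<Sum>i\<in>A. \<Sum>j\<in>A. (p \<pi> i j - q \<pi> i j) * E \<pi>)"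
      by (simp add: sum.swap[of _ ?P A])
    also have "\<dots> = (\<Sum>\<pi>\<in>?P. ((\<Sum>i\<in>A. \<Sum>j\<in>A. p \<pi> i j) - (\<Sum>i\<in>A. \<Sum>j\<in>A. q \<pi> i j)) * E \<pi>)"
      by (simp add: sum_subtractf sum_distrib_right left_diff_distrib)
    also have "\<dots> = (\<Sum>\<pi>\<in>?P. 2 * ?n * ((X \<pi> - \<mu>) * E \<pi>))"
      by (intro sum.cong refl) (simp only: sum_p sum_q, simp add: algebra_simps)
    finally show ?thesis by (simp add: sum_distrib_left)
  qed
  have rhs: "(\<Sum>i\<in>A. \<Sum>j\<in>A. \<Sum>\<pi>\<in>?P. (p \<pi> i j + q \<pi> i j) * E \<pi>) =
      2 * ?n * (\<Sum>\<pi>\<in>?P. (X \<pi> + \<mu>) * E \<pi>)"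
  proof -
    have "(\<Sum>i\<in>A. \<Sum>j\<in>A. \<Sum>\<pi>\<in>?P. (p \<pi> i j + q \<pi> i j) * E \<pi>) =
        (\<Sum>\<pi>\<in>?P. \<Sum>i\<in>A. \<Sum>j\<in>A. (p \<pi> i j + q \<pi> i j) * E \<pi>)"
      by (simp add: sum.swap[of _ ?P A])
    also have "\<dots> = (\<Sum>\<pi>\<in>?P. ((\<Sum>i\<in>A. \<Sum>j\<in>A. p \<pi> i j) + (\<Sum>i\<in>A. \<Sum>j\<in>A. q \<pi> i j)) * E \<pi>)"
      by (simp add: sum.distrib sum_distrib_right distrib_right)
    also have "\<dots> = (\<Sum>\<pi>\<in>?P. 2 * ?n * ((X \<pi> + \<mu>) * E \<pi>))"
      by (intro sum.cong refl) (simp only: sum_p sum_q, simp add: algebra_simps)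
    finally show ?thesis by (simp add: sum_distrib_left)
  qed
  have "2 * ?n * \<bar>\<Sum>\<pi>\<in>?P. (X \<pi> - \<mu>) * E \<pi>\<bar> =
      \<bar>\<Sum>i\<in>A. \<Sum>j\<in>A. \<Sum>\<pi>\<in>?P. (X \<pi> - X (\<tau> \<pi> i j)) * E \<pi>\<bar>"
    by (simp add: lhs abs_mult)
  also have "\<dots> \<le> (\<Sum>i\<in>A. \<Sum>j\<in>A. \<bar>\<Sum>\<pi>\<in>?P. (X \<pi> - X (\<tau> \<pi> i j)) * E \<pi>\<bar>)"
    by (rule order_trans[OF sum_abs sum_mono[OF sum_abs]])
  also have "\<dots> \<le> (\<Sum>i\<in>A. \<Sum>j\<in>A. \<bar>\<theta>\<bar> * (\<Sum>\<pi>\<in>?P. (p \<pi> i j + q \<pi> i j) * E \<pi>))"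
    by (intro sum_mono pair)
  also have "\<dots> = 2 * ?n * (\<bar>\<theta>\<bar> * (\<Sum>\<pi>\<in>?P. (X \<pi> + \<mu>) * E \<pi>))"
    by (simp add: rhs flip: sum_distrib_left)
  finally show ?thesis using npos unfolding E_def by simp
qed

text \<open>
  For the moment \<open>m \<theta> = E e^(\<theta>X)\<close> the preceding lemma reads
  \<open>|m' - \<mu> m| \<le> |\<theta>| (m' + \<mu> m)\<close>, which bounds the logarithmic derivative of \<open>m\<close> by
  \<open>\<mu>(1 + 4\<theta>)\<close> from above on \<open>[0,1/2]\<close> and from below for negative \<open>\<theta>\<close>. So
  \<open>m \<theta> e^(-\<mu>(\<theta> + 2\<theta>^2))\<close> has its maximum at \<open>0\<close>. Up to the constant in front
  of \<open>\<theta>^2\<close> this is the bound satisfied by a Poisson variable of mean \<open>\<mu>\<close>.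
\<close>

lemma perm_mean_exp_le:
  fixes a :: "'a \<Rightarrow> 'a \<Rightarrow> real" and \<theta> :: real
  assumes fin: "finite A" and ne: "A \<noteq> {}"
    and a01: "\<And>r w. r \<in> A \<Longrightarrow> w \<in> A \<Longrightarrow> 0 \<le> a r w \<and> a r w \<le> 1"
    and \<theta>: "\<theta> \<le> 1 / 2"
  shows "perm_mean A (\<lambda>\<pi>. exp (\<theta> * (\<Sum>r\<in>A. a r (\<pi> r)))) \<le>
    exp ((\<theta> + 2 * \<theta>\<^sup>2) * ((\<Sum>r\<in>A. \<Sum>w\<in>A. a r w) / real (card A)))"
proof -
  let ?P = "{\<pi>. \<pi> permutes A}"
  define X where "X \<pi> = (\<Sum>r\<in>A. a r (\<pi> r))" for \<pi>
  define \<mu> where "\<mu> = (\<Sum>r\<in>A. \<Sum>w\<in>A. a r w) / real (card A)"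
  define m where "m t = (\<Sum>\<pi>\<in>?P. exp (t * X \<pi>))" for t
  define m' where "m' t = (\<Sum>\<pi>\<in>?P. X \<pi> * exp (t * X \<pi>))" for t
  define q where "q t = m t * exp (- \<mu> * (t + 2 * t\<^sup>2))" for t
  have mu0: "0 \<le> \<mu>" unfolding \<mu>_def using a01 by (intro divide_nonneg_nonneg sum_nonneg) auto
  have m0: "0 \<le> m t" for t unfolding m_def by (intro sum_nonneg) auto
  have key: "\<bar>m' t - \<mu> * m t\<bar> \<le> \<bar>t\<bar> * (m' t + \<mu> * m t)" for t
    using abs_exp_moment_centred_le[OF fin ne a01, where \<theta> = t]
    by (simp add: m_def m'_def X_def \<mu>_def left_diff_distrib distrib_right sum_subtractf
        sum.distrib sum_distrib_left)
  have dm: "(m has_real_derivative m' t) (at t)" for t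
    unfolding m_def m'_def by (auto intro!: derivative_eq_intros sum.cong)
  define q' where "q' t = (m' t - \<mu> * (1 + 4 * t) * m t) * exp (- \<mu> * (t + 2 * t\<^sup>2))" for t
  have dq: "(q has_real_derivative q' t) (at t)" for t
    unfolding q_def q'_def
    by (auto intro!: derivative_eq_intros dm simp: algebra_simps power2_eq_square)
  have "q \<theta> \<le> q 0"
  proof (cases "0 \<le> \<theta>")
    case True
    show ?thesis
    proof (rule DERIV_nonpos_imp_nonincreasing[OF True])
      fix t assume t: "0 \<le> t" "t \<le> \<theta>"
      have "(1 - t) * m' t \<le> (1 + t) * (\<mu> * m t)" using key[of t] t by (simp add: algebra_simps)
      also have "\<dots> \<le> ((1 - t) * (1 + 4 * t)) * (\<mu> * m t)"
      proof (intro mult_right_mono)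
        have "t * t \<le> t * (1 / 2)" using t \<theta> by (intro mult_left_mono) auto
        then show "1 + t \<le> (1 - t) * (1 + 4 * t)" by (simp add: algebra_simps)
      qed (simp add: mu0 m0)
      finally have "(1 - t) * m' t \<le> (1 - t) * ((1 + 4 * t) * (\<mu> * m t))"
        by (simp only: mult.assoc)
      then have "m' t \<le> (1 + 4 * t) * (\<mu> * m t)" using t \<theta> by simp
      then have "q' t \<le> 0" unfolding q'_def
        by (intro mult_nonpos_nonneg) (simp_all add: algebra_simps)
      then show "\<exists>y. (q has_real_derivative y) (at t) \<and> y \<le> 0" using dq by blast
    qed
  next
    case False
    show ?thesis
    proof (rule DERIV_nonneg_imp_nondecreasing[where f = q and a = \<theta> and b = 0])
      show "\<theta> \<le> 0" using False by simp
      fix t assume t: "\<theta> \<le> t" "t \<le> 0"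
      have "((1 - t) * (1 + 4 * t)) * (\<mu> * m t) \<le> (1 + t) * (\<mu> * m t)"
      proof (intro mult_right_mono)
        have "0 \<le> t * t" by simp
        then show "(1 - t) * (1 + 4 * t) \<le> 1 + t"
          using t by (simp add: algebra_simps del: zero_le_square)
      qed (simp add: mu0 m0)
      also have "\<dots> \<le> (1 - t) * m' t" using key[of t] t by (simp add: algebra_simps)
      finally have "(1 - t) * ((1 + 4 * t) * (\<mu> * m t)) \<le> (1 - t) * m' t"
        by (simp only: mult.assoc)
      then have "(1 + 4 * t) * (\<mu> * m t) \<le> m' t" using t by simp
      then have "0 \<le> q' t" unfolding q'_def
        by (intro mult_nonneg_nonneg) (simp_all add: algebra_simps)
      then show "\<exists>y. (q has_real_derivative y) (at t) \<and> 0 \<le> y" using dq by blast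
    qed
  qed
  moreover have "q 0 = real (card ?P)" by (simp add: q_def m_def)
  ultimately have "m \<theta> * exp (- \<mu> * (\<theta> + 2 * \<theta>\<^sup>2)) \<le> real (card ?P)" by (simp add: q_def)
  then have "m \<theta> \<le> real (card ?P) * exp ((\<theta> + 2 * \<theta>\<^sup>2) * \<mu>)"
    by (simp add: exp_minus divide_simps mult.commute)
  then show ?thesis
    using card_permutes_pos[OF fin]
    by (simp add: perm_mean_def m_def X_def \<mu>_def divide_simps mult.commute)
qed

section \<open>Revealing a random perfect matching coordinate by coordinate\<close>

lemma finite_tuples: "finite (tuples n k)"
  by (simp add: tuples_def finite_PiE)

lemma card_tuples_fixed_le:
  assumes "L \<subseteq> {1..k}"
  shows "card {T \<in> tuples n k. \<forall>l\<in>L. T l = t l} \<le> n ^ (k - card L)"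
proof -
  let ?S = "{T \<in> tuples n k. \<forall>l\<in>L. T l = t l}" and ?L' = "{1..k} - L"
  have "inj_on (\<lambda>T. restrict T ?L') ?S"
  proof (rule inj_onI)
    fix T T' assume T: "T \<in> ?S" and T': "T' \<in> ?S" and eq: "restrict T ?L' = restrict T' ?L'"
    show "T = T'"
    proof
      fix l
      consider "l \<in> L" | "l \<in> ?L'" | "l \<notin> {1..k}" by blast
      then show "T l = T' l"
      proof cases
        case 1
        then show ?thesis using T T' by simp
      next
        case 2
        then show ?thesis using fun_cong[OF eq, of l] by simp
      next
        case 3
        then show ?thesis using T T' PiE_arb unfolding tuples_def by fastforce
      qed
    qed
  qed
  moreover have "(\<lambda>T. restrict T ?L') ` ?S \<subseteq> ?L' \<rightarrow>\<^sub>E {1..n}"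
  proof (rule image_subsetI)
    fix T assume "T \<in> ?S"
    then show "restrict T ?L' \<in> ?L' \<rightarrow>\<^sub>E {1..n}"
      unfolding tuples_def restrict_PiE_iff by blast
  qed
  ultimately have "card ?S \<le> card (?L' \<rightarrow>\<^sub>E {1..n})"
    by (intro card_inj_on_le) (auto simp: finite_PiE)
  also have "\<dots> = n ^ card ?L'" by (simp add: card_PiE)
  also have "card ?L' = k - card L" using assms by (simp add: card_Diff_subset finite_subset)
  finally show ?thesis .
qed

text \<open>
  The permutations \<open>\<sigma> 1, \<dots>, \<sigma> k\<close> encode the perfect matching whose rows \<open>r \<in> {1..n}\<close> are the tuples
  \<open>(\<sigma> 1 r, \<dots>, \<sigma> k r)\<close>. Only the first \<open>j\<close> entries of the rows enter, so that the set can be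
  followed while the permutations are revealed.
\<close>

definition hit :: "nat \<Rightarrow> (nat \<Rightarrow> nat \<Rightarrow> nat) \<Rightarrow> nat \<Rightarrow> (nat \<Rightarrow> nat set) \<Rightarrow> nat set" where
  "hit n \<sigma> j H = {r \<in> {1..n}. \<exists>l\<in>{1..j}. \<sigma> l r \<in> H l}"

text \<open>
  The pairs of a row and a tuple of \<open>R\<close> that are still compatible after \<open>j\<close> coordinates have been
  revealed. Divided by \<open>n^(k-j)\<close>, their number is the conditional expectation of the number of rows
  that belong to \<open>R\<close>; for \<open>j = k\<close> it is this number.
\<close>

definition agreeing ::
  "nat \<Rightarrow> (nat \<Rightarrow> nat \<Rightarrow> nat) \<Rightarrow> nat \<Rightarrow> (nat \<Rightarrow> nat) set \<Rightarrow> (nat \<times> (nat \<Rightarrow> nat)) set" where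
  "agreeing n \<sigma> j R = {(r, T). r \<in> {1..n} \<and> T \<in> R \<and> (\<forall>l\<in>{1..j}. T l = \<sigma> l r)}"

lemma card_permutes_vimage:
  assumes "\<pi> permutes A" and "B \<subseteq> A"
  shows "card {r \<in> A. \<pi> r \<in> B} = card B"
proof -
  have "{r \<in> A. \<pi> r \<in> B} = \<pi> -` B"
    using assms permutes_in_image by fastforce
  then show ?thesis
    using assms(1) by (simp add: card_vimage_inj permutes_inj permutes_surj)
qed

lemma card_hit_le:
  assumes perm: "\<And>l. l \<in> {1..j} \<Longrightarrow> \<sigma> l permutes {1..n}"
    and H: "\<And>l. l \<in> {1..j} \<Longrightarrow> H l \<subseteq> {1..n} \<and> card (H l) \<le> s"
  shows "card (hit n \<sigma> j H) \<le> j * s"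
proof -
  have "hit n \<sigma> j H = (\<Union>l\<in>{1..j}. {r \<in> {1..n}. \<sigma> l r \<in> H l})" by (auto simp: hit_def)
  then have "card (hit n \<sigma> j H) \<le> (\<Sum>l\<in>{1..j}. card {r \<in> {1..n}. \<sigma> l r \<in> H l})"
    by (simp add: card_UN_le)
  also have "\<dots> \<le> (\<Sum>l\<in>{1..j}. s)"
    using card_permutes_vimage[OF perm] H by (intro sum_mono) simp
  finally show ?thesis by simp
qed

text \<open>
  Revealing coordinate \<open>j+1\<close> replaces the scaled number of compatible pairs by a sum along the new
  permutation of entries \<open>a r w\<close>, the scaled numbers of compatible tuples with value \<open>w\<close> there.
  The new exponent \<open>c - 2c^2\<close> is the price of one application of the moment bound.
\<close>

lemma perm_mean_agreeing_step:
  fixes c :: real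
  assumes n: "0 < n" and j: "j < k" and R: "R \<subseteq> tuples n k" and c: "0 \<le> c"
  shows "perm_mean {1..n} (\<lambda>\<pi>. exp (- c *
      (card (agreeing n (\<sigma>(Suc j := \<pi>)) (Suc j) R) / real n ^ (k - Suc j)))) \<le>
    exp (- (c - 2 * c\<^sup>2) * (card (agreeing n \<sigma> j R) / real n ^ (k - j)))"
proof -
  define S where "S r = {T \<in> R. \<forall>l\<in>{1..j}. T l = \<sigma> l r}" for r
  define a where "a r w = card {T \<in> S r. T (Suc j) = w} / real n ^ (k - Suc j)" for r w
  have finR: "finite R" using R finite_tuples finite_subset by blast
  have finS: "finite (S r)" for r using finR by (simp add: S_def)
  have a01: "0 \<le> a r w \<and> a r w \<le> 1" for r w
  proof -
    have "{T \<in> S r. T (Suc j) = w} \<subseteq>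
        {T \<in> tuples n k. \<forall>l\<in>{1..Suc j}. T l = (if l = Suc j then w else \<sigma> l r)}"
      using R by (auto simp: S_def)
    then have "card {T \<in> S r. T (Suc j) = w} \<le>
        card {T \<in> tuples n k. \<forall>l\<in>{1..Suc j}. T l = (if l = Suc j then w else \<sigma> l r)}"
      by (intro card_mono) (simp_all add: finite_tuples)
    also have "\<dots> \<le> n ^ (k - card {1..Suc j})"
      using j by (intro card_tuples_fixed_le) auto
    finally have "real (card {T \<in> S r. T (Suc j) = w}) \<le> real (n ^ (k - Suc j))"
      by (simp only: card_atLeastAtMost of_nat_le_iff) simp
    then show ?thesis using n by (simp add: a_def divide_le_eq_1)
  qed
  have next_sum: "(\<Sum>r\<in>{1..n}. a r (\<pi> r)) =
      card (agreeing n (\<sigma>(Suc j := \<pi>)) (Suc j) R) / real n ^ (k - Suc j)" for \<pi>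
  proof -
    have "agreeing n (\<sigma>(Suc j := \<pi>)) (Suc j) R =
        Sigma {1..n} (\<lambda>r. {T \<in> S r. T (Suc j) = \<pi> r})"
      by (auto simp: agreeing_def S_def le_Suc_eq)
    then have "card (agreeing n (\<sigma>(Suc j := \<pi>)) (Suc j) R) =
        (\<Sum>r\<in>{1..n}. card {T \<in> S r. T (Suc j) = \<pi> r})"
      using finS by simp
    then show ?thesis by (simp add: a_def flip: sum_divide_distrib)
  qed
  have mean: "(\<Sum>r\<in>{1..n}. \<Sum>w\<in>{1..n}. a r w) / real (card {1..n}) =
      card (agreeing n \<sigma> j R) / real n ^ (k - j)"
  proof -
    have "(\<Sum>w\<in>{1..n}. card {T \<in> S r. T (Suc j) = w}) = card (S r)" for r
    proof -
      have "(\<lambda>T. T (Suc j)) ` S r \<subseteq> {1..n}"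
        using R j unfolding S_def tuples_def by fastforce
      from sum.group[OF finS finite_atLeastAtMost this, of "\<lambda>_. 1::nat"]
      show ?thesis by simp
    qed
    then have row: "(\<Sum>w\<in>{1..n}. a r w) = card (S r) / real n ^ (k - Suc j)" for r
      by (simp add: a_def flip: sum_divide_distrib of_nat_sum)
    have "agreeing n \<sigma> j R = Sigma {1..n} S" by (auto simp: agreeing_def S_def)
    then have "card (agreeing n \<sigma> j R) = (\<Sum>r\<in>{1..n}. card (S r))" using finS by simp
    moreover have "k - j = Suc (k - Suc j)" using j by simp
    ultimately show ?thesis unfolding row by (simp flip: sum_divide_distrib)
  qed
  have "perm_mean {1..n} (\<lambda>\<pi>. exp (- c * (\<Sum>r\<in>{1..n}. a r (\<pi> r)))) \<le>
      exp ((- c + 2 * (- c)\<^sup>2) * ((\<Sum>r\<in>{1..n}. \<Sum>w\<in>{1..n}. a r w) / real (card {1..n})))"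
    using n c a01 by (intro perm_mean_exp_le) auto
  moreover have "- c + 2 * (- c)\<^sup>2 = - (c - 2 * c\<^sup>2)" by simp
  ultimately show ?thesis unfolding next_sum mean by simp
qed

text \<open>
  Let \<open>P\<close> be the probability that a row escapes all coordinates after \<open>j+1\<close>. With \<open>u\<close> rows hit so
  far, \<open>n - (n - u)(1 - h/n) P\<close> rows are expected to be hit at the end. When coordinate \<open>j+1\<close> is
  revealed, this expectation changes only through the overlap of the \<open>h\<close> rows that this coordinate
  hits with the \<open>u\<close> old ones. Applying the moment bound to this overlap, of mean \<open>u h / n\<close>,
  instead of to the number of hit rows makes the error term small.
\<close>

lemma perm_mean_hit_step:
  fixes P \<beta> :: real and \<sigma> :: "nat \<Rightarrow> nat \<Rightarrow> nat" and H :: "nat \<Rightarrow> nat set" and n j :: nat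
    and u h :: real
  defines "u \<equiv> real (card (hit n \<sigma> j H))" and "h \<equiv> real (card (H (Suc j)))"
  assumes n: "0 < n" and H: "H (Suc j) \<subseteq> {1..n}"
    and P: "0 \<le> P" "P \<le> 1" and lam: "0 \<le> \<beta>" "\<beta> \<le> 1 / 2"
  shows "perm_mean {1..n} (\<lambda>\<pi>. exp (- \<beta> *
      (n - (n - real (card (hit n (\<sigma>(Suc j := \<pi>)) (Suc j) H))) * P))) \<le>
    exp (- \<beta> * (n - (n - u) * ((1 - h / n) * P)) + 2 * \<beta>\<^sup>2 * (u * h / n))"
proof -
  let ?U = "hit n \<sigma> j H" and ?H = "H (Suc j)"
  define a :: "nat \<Rightarrow> nat \<Rightarrow> real" where "a r w = (if r \<in> ?U \<and> w \<in> ?H then 1 else 0)" for r w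
  define c where "c = \<beta> * P"
  have UA: "?U \<subseteq> {1..n}" by (auto simp: hit_def)
  have finU: "finite ?U" using UA finite_subset by blast
  have finH: "finite ?H" using H finite_subset by blast
  have c0: "0 \<le> c" using P lam by (simp add: c_def)
  have c1: "c \<le> \<beta>" using P lam by (simp add: c_def mult_left_le)
  have overlap: "(\<Sum>r\<in>{1..n}. a r (\<pi> r)) = u + h - card (hit n (\<sigma>(Suc j := \<pi>)) (Suc j) H)"
    if "\<pi> permutes {1..n}" for \<pi>
  proof -
    let ?V = "{r \<in> {1..n}. \<pi> r \<in> ?H}"
    have "{1..Suc j} = insert (Suc j) {1..j}" by auto
    then have "hit n (\<sigma>(Suc j := \<pi>)) (Suc j) H = ?U \<union> ?V"
      unfolding hit_def by (auto split: if_splits)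
    moreover have "card ?U + card ?V = card (?U \<union> ?V) + card (?U \<inter> ?V)"
      by (intro card_Un_Int) (simp_all add: finU)
    moreover have "card ?V = card ?H" by (rule card_permutes_vimage[OF that H])
    moreover have "(\<Sum>r\<in>{1..n}. a r (\<pi> r)) = card (?U \<inter> ?V)"
    proof -
      have "(\<Sum>r\<in>{1..n}. a r (\<pi> r)) = (\<Sum>r\<in>?U \<inter> ?V. a r (\<pi> r))"
        using UA by (intro sum.mono_neutral_right) (auto simp: a_def)
      also have "\<dots> = (\<Sum>r\<in>?U \<inter> ?V. 1)" by (intro sum.cong) (auto simp: a_def)
      also have "\<dots> = real (card (?U \<inter> ?V))" by simp
      finally show ?thesis .
    qed
    ultimately show ?thesis by (simp add: u_def h_def)
  qed
  have "(\<Sum>r\<in>{1..n}. \<Sum>w\<in>{1..n}. a r w) = u * h"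
  proof -
    have "(\<Sum>w\<in>{1..n}. a r w) = (if r \<in> ?U then h else 0)" for r
    proof -
      have "{1..n} \<inter> ?H = ?H" using H by blast
      then show ?thesis by (simp add: a_def h_def sum.If_cases)
    qed
    moreover have "{1..n} \<inter> ?U = ?U" using UA by blast
    ultimately show ?thesis by (simp add: sum.If_cases u_def)
  qed
  then have mean: "(\<Sum>r\<in>{1..n}. \<Sum>w\<in>{1..n}. a r w) / real (card {1..n}) = u * h / n" by simp
  have "perm_mean {1..n} (\<lambda>\<pi>. exp (c * (\<Sum>r\<in>{1..n}. a r (\<pi> r)))) \<le>
      exp ((c + 2 * c\<^sup>2) * ((\<Sum>r\<in>{1..n}. \<Sum>w\<in>{1..n}. a r w) / real (card {1..n})))"
    using n c1 lam by (intro perm_mean_exp_le) (auto simp: a_def)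
  then have mgf: "perm_mean {1..n} (\<lambda>\<pi>. exp (c * (\<Sum>r\<in>{1..n}. a r (\<pi> r)))) \<le>
      exp ((c + 2 * c\<^sup>2) * (u * h / n))"
    unfolding mean .
  have "perm_mean {1..n} (\<lambda>\<pi>. exp (- \<beta> *
      (n - (n - real (card (hit n (\<sigma>(Suc j := \<pi>)) (Suc j) H))) * P))) \<le>
    perm_mean {1..n} (\<lambda>\<pi>. exp (- \<beta> * (n - (n - u - h) * P)) * exp (c * (\<Sum>r\<in>{1..n}. a r (\<pi> r))))"
  proof (rule perm_mean_mono)
    fix \<pi> :: "nat \<Rightarrow> nat" assume perm: "\<pi> permutes {1..n}"
    show "exp (- \<beta> * (n - (n - real (card (hit n (\<sigma>(Suc j := \<pi>)) (Suc j) H))) * P)) \<le>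
        exp (- \<beta> * (n - (n - u - h) * P)) * exp (c * (\<Sum>r\<in>{1..n}. a r (\<pi> r)))"
      unfolding overlap[OF perm] c_def exp_add[symmetric] by (simp add: algebra_simps)
  qed
  also have "\<dots> = exp (- \<beta> * (n - (n - u - h) * P)) *
      perm_mean {1..n} (\<lambda>\<pi>. exp (c * (\<Sum>r\<in>{1..n}. a r (\<pi> r))))"
    by (rule perm_mean_mult_left)
  also have "\<dots> \<le> exp (- \<beta> * (n - (n - u - h) * P)) * exp ((c + 2 * c\<^sup>2) * (u * h / n))"
    using mgf by (intro mult_left_mono) auto
  also have "\<dots> = exp (- \<beta> * (n - (n - u - h) * P) + (c + 2 * c\<^sup>2) * (u * h / n))"
    by (rule exp_add[symmetric])
  also have "\<dots> \<le> exp (- \<beta> * (n - (n - u) * ((1 - h / n) * P)) + 2 * \<beta>\<^sup>2 * (u * h / n))"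
  proof -
    define y where "y = u * h / n"
    have "(n - u) * (1 - h / n) = n - u - h + y"
      using n by (simp add: y_def field_simps)
    then have eq: "(n - u) * ((1 - h / n) * P) = (n - u - h) * P + y * P"
      by (metis distrib_right mult.assoc)
    have "- \<beta> * (n - (n - u) * ((1 - h / n) * P)) = - \<beta> * (n - (n - u - h) * P) + c * y"
      unfolding eq c_def by (simp add: algebra_simps)
    moreover have "c\<^sup>2 * y \<le> \<beta>\<^sup>2 * y"
      using c0 c1 by (intro mult_right_mono power_mono) (auto simp: u_def h_def y_def)
    ultimately show ?thesis by (simp add: distrib_right flip: y_def)
  qed
  finally show ?thesis .
qed

text \<open>
  The exponent after \<open>m\<close> applications of \<open>perm_mean_agreeing_step\<close>, counted from the last
  coordinate backwards.
\<close>

primrec rate :: "real \<Rightarrow> nat \<Rightarrow> real" where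
  "rate \<beta> 0 = \<beta>"
| "rate \<beta> (Suc m) = rate \<beta> m - 2 * (rate \<beta> m)\<^sup>2"

lemma rate_bounds:
  assumes "0 \<le> \<beta>" and "\<beta> \<le> 1 / 2"
  shows "0 \<le> rate \<beta> m \<and> rate \<beta> m \<le> \<beta> \<and> \<beta> - 2 * m * \<beta>\<^sup>2 \<le> rate \<beta> m"
proof (induction m)
  case 0
  then show ?case using assms by simp
next
  case (Suc m)
  let ?g = "rate \<beta> m"
  have "?g * (2 * ?g) \<le> ?g * 1" using Suc assms by (intro mult_left_mono) auto
  then have "2 * ?g\<^sup>2 \<le> ?g" by (simp add: power2_eq_square)
  moreover have "0 \<le> ?g\<^sup>2" "?g\<^sup>2 \<le> \<beta>\<^sup>2" using Suc by (auto intro: power_mono)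
  moreover have "\<beta> - 2 * Suc m * \<beta>\<^sup>2 = (\<beta> - 2 * m * \<beta>\<^sup>2) - 2 * \<beta>\<^sup>2" by (simp add: algebra_simps)
  ultimately show ?case using Suc unfolding rate.simps by linarith
qed

text \<open>
  The method of conditional expectations. The potential \<open>\<Phi> j\<close> has one term for the rows hit and one
  for the rows agreeing, for every \<open>i\<close>; each is a weighted moment bound for the final number,
  conditional on the first \<open>j\<close> permutations. By the two step lemmas the mean of \<open>\<Phi> (j+1)\<close> over the next
  permutation is at most \<open>\<Phi> j\<close>, so some permutation does not increase it. Every step taken from
  \<open>j < k\<close> has at most \<open>(k-1)s\<close> rows hit, so \<open>\<kappa>\<close> bounds the error term of each step.
\<close>

lemma exists_permutations_potential_le:
  fixes H :: "'e \<Rightarrow> nat \<Rightarrow> nat set" and R :: "'e \<Rightarrow> (nat \<Rightarrow> nat) set" and \<beta> :: real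
  assumes n: "0 < n" and lam: "0 \<le> \<beta>" "\<beta> \<le> 1 / 2"
    and H: "\<And>i l. i \<in> E \<Longrightarrow> l \<in> {1..k} \<Longrightarrow> H i l \<subseteq> {1..n} \<and> card (H i l) \<le> s"
    and R: "\<And>i. i \<in> E \<Longrightarrow> R i \<subseteq> tuples n k"
    and b: "\<And>i. i \<in> E \<Longrightarrow> 0 \<le> b i" and b': "\<And>i. i \<in> E \<Longrightarrow> 0 \<le> b' i"
  defines "\<kappa> \<equiv> 2 * \<beta>\<^sup>2 * (real (k - 1) * s * s / n)"
  obtains \<sigma> where "\<forall>l\<in>{1..k}. \<sigma> l permutes {1..n}"
    and "(\<Sum>i\<in>E. b i * exp (- \<beta> * card (hit n \<sigma> k (H i))) +
           b' i * exp (- \<beta> * card (agreeing n \<sigma> k (R i)))) \<le>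
         (\<Sum>i\<in>E. b i * exp (- \<beta> * (n - n * (\<Prod>l\<in>{1..k}. 1 - card (H i l) / n)) + k * \<kappa>) +
           b' i * exp (- rate \<beta> k * (n * card (R i) / real n ^ k)))"
proof -
  define P where "P i j = (\<Prod>l\<in>{Suc j..k}. 1 - real (card (H i l)) / n)" for i j
  define \<Phi> where "\<Phi> j \<sigma> = (\<Sum>i\<in>E.
      b i * exp (- \<beta> * (n - (n - real (card (hit n \<sigma> j (H i)))) * P i j) + real (k - j) * \<kappa>) +
      b' i * exp (- rate \<beta> (k - j) * (card (agreeing n \<sigma> j (R i)) / real n ^ (k - j))))" for j \<sigma>
  have h1: "0 \<le> 1 - real (card (H i l)) / n \<and> 1 - real (card (H i l)) / n \<le> 1"
    if "i \<in> E" "l \<in> {1..k}" for i l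
    using H[OF that] n card_mono[of "{1..n}" "H i l"] by simp
  have P01: "0 \<le> P i j \<and> P i j \<le> 1" if "i \<in> E" for i j
  proof
    show "0 \<le> P i j" unfolding P_def using h1[OF that] by (intro prod_nonneg) auto
    show "P i j \<le> 1" unfolding P_def using h1[OF that] by (intro prod_le_1) auto
  qed
  have step: "perm_mean {1..n} (\<lambda>\<pi>. \<Phi> (Suc j) (\<sigma>(Suc j := \<pi>))) \<le> \<Phi> j \<sigma>"
    if j: "j < k" and \<sigma>: "\<forall>l\<in>{1..j}. \<sigma> l permutes {1..n}" for j \<sigma>
  proof -
    have kj: "k - j = Suc (k - Suc j)" using j by simp
    let ?G = "\<lambda>i \<pi>. exp (- \<beta> * (n - (n - real (card (hit n (\<sigma>(Suc j := \<pi>)) (Suc j) (H i)))) * P i (Suc j)))"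
    let ?R = "\<lambda>i \<pi>. exp (- rate \<beta> (k - Suc j) *
      (card (agreeing n (\<sigma>(Suc j := \<pi>)) (Suc j) (R i)) / real n ^ (k - Suc j)))"
    have "perm_mean {1..n} (\<lambda>\<pi>. \<Phi> (Suc j) (\<sigma>(Suc j := \<pi>))) =
        (\<Sum>i\<in>E. b i * exp (real (k - Suc j) * \<kappa>) * perm_mean {1..n} (?G i) +
          b' i * perm_mean {1..n} (?R i))"
      unfolding \<Phi>_def perm_mean_sum perm_mean_add exp_add
      by (simp flip: perm_mean_mult_left add: mult_ac)
    also have "\<dots> \<le> \<Phi> j \<sigma>"
      unfolding \<Phi>_def
    proof (intro sum_mono add_mono)
      fix i assume i: "i \<in> E"
      define u where "u = real (card (hit n \<sigma> j (H i)))"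
      define h where "h = real (card (H i (Suc j)))"
      have "card (hit n \<sigma> j (H i)) \<le> j * s"
        using \<sigma> H[OF i] j by (intro card_hit_le) auto
      also have "\<dots> \<le> (k - 1) * s" using j by (intro mult_right_mono) auto
      finally have u: "u \<le> real (k - 1) * s" unfolding u_def by (simp only: of_nat_mult flip: of_nat_le_iff[where 'a = real])
      have "h \<le> s" using H[OF i, of "Suc j"] j by (simp add: h_def)
      then have "u * h / n \<le> real (k - 1) * s * s / n"
        using u by (intro divide_right_mono mult_mono) (auto simp: h_def)
      then have corr: "2 * \<beta>\<^sup>2 * (u * h / n) \<le> \<kappa>"
        unfolding \<kappa>_def by (intro mult_left_mono) auto
      have Pj: "P i j = (1 - h / n) * P i (Suc j)"
        unfolding P_def h_def using j by (simp add: prod.atLeast_Suc_atMost)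
      have "perm_mean {1..n} (?G i) \<le>
          exp (- \<beta> * (n - (n - u) * ((1 - h / n) * P i (Suc j))) + 2 * \<beta>\<^sup>2 * (u * h / n))"
        unfolding u_def h_def using n P01[OF i] lam H[OF i, of "Suc j"] j
        by (intro perm_mean_hit_step) auto
      also have "\<dots> \<le> exp (- \<beta> * (n - (n - u) * P i j) + \<kappa>)"
        using corr by (simp add: Pj)
      finally have "perm_mean {1..n} (?G i) \<le> exp (- \<beta> * (n - (n - u) * P i j) + \<kappa>)" .
      then have "b i * exp (real (k - Suc j) * \<kappa>) * perm_mean {1..n} (?G i) \<le>
          b i * exp (real (k - Suc j) * \<kappa>) * exp (- \<beta> * (n - (n - u) * P i j) + \<kappa>)"
        using b[OF i] by (intro mult_left_mono) auto
      also have "\<dots> = b i * exp (- \<beta> * (n - (n - u) * P i j) + real (k - j) * \<kappa>)"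
        by (simp add: kj mult.assoc exp_add[symmetric] algebra_simps)
      finally show "b i * exp (real (k - Suc j) * \<kappa>) * perm_mean {1..n} (?G i) \<le>
        b i * exp (- \<beta> * (n - (n - real (card (hit n \<sigma> j (H i)))) * P i j) + real (k - j) * \<kappa>)"
        unfolding u_def .
      have "perm_mean {1..n} (?R i) \<le>
          exp (- (rate \<beta> (k - Suc j) - 2 * (rate \<beta> (k - Suc j))\<^sup>2) *
            (card (agreeing n \<sigma> j (R i)) / real n ^ (k - j)))"
        using n j R[OF i] rate_bounds[OF lam] by (intro perm_mean_agreeing_step) auto
      then show "b' i * perm_mean {1..n} (?R i) \<le> b' i * exp (- rate \<beta> (k - j) *
          (card (agreeing n \<sigma> j (R i)) / real n ^ (k - j)))"
        using b'[OF i] unfolding kj rate.simps by (intro mult_left_mono) auto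
    qed
    finally show ?thesis .
  qed
  have "\<exists>\<sigma>. (\<forall>l\<in>{1..j}. \<sigma> l permutes {1..n}) \<and> \<Phi> j \<sigma> \<le> \<Phi> 0 (\<lambda>_. id)" if "j \<le> k" for j
    using that
  proof (induction j)
    case 0
    then show ?case by (intro exI[of _ "\<lambda>_. id"]) simp
  next
    case (Suc j)
    then obtain \<sigma> where \<sigma>: "\<forall>l\<in>{1..j}. \<sigma> l permutes {1..n}" "\<Phi> j \<sigma> \<le> \<Phi> 0 (\<lambda>_. id)"
      using Suc_leD by blast
    obtain \<pi> where \<pi>: "\<pi> permutes {1..n}"
        "\<Phi> (Suc j) (\<sigma>(Suc j := \<pi>)) \<le> perm_mean {1..n} (\<lambda>\<pi>. \<Phi> (Suc j) (\<sigma>(Suc j := \<pi>)))"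
      using exists_le_perm_mean[of "{1..n}" "\<lambda>\<pi>. \<Phi> (Suc j) (\<sigma>(Suc j := \<pi>))"] by auto
    have "\<Phi> (Suc j) (\<sigma>(Suc j := \<pi>)) \<le> \<Phi> 0 (\<lambda>_. id)"
      using \<pi>(2) step[of j \<sigma>] \<sigma> Suc.prems by linarith
    moreover have "\<forall>l\<in>{1..Suc j}. (\<sigma>(Suc j := \<pi>)) l permutes {1..n}"
      using \<sigma>(1) \<pi>(1) by (auto simp: le_Suc_eq)
    ultimately show ?case by blast
  qed
  from this[of k] obtain \<sigma> where \<sigma>: "\<forall>l\<in>{1..k}. \<sigma> l permutes {1..n}" "\<Phi> k \<sigma> \<le> \<Phi> 0 (\<lambda>_. id)"
    by auto
  have "card (agreeing n (\<lambda>_. id) 0 (R i)) = n * card (R i)" for i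
  proof -
    have "agreeing n (\<lambda>_. id) 0 (R i) = {1..n} \<times> R i" by (auto simp: agreeing_def)
    then show ?thesis by (simp add: card_cartesian_product)
  qed
  then have "\<Phi> 0 (\<lambda>_. id) =
      (\<Sum>i\<in>E. b i * exp (- \<beta> * (n - n * (\<Prod>l\<in>{1..k}. 1 - card (H i l) / n)) + k * \<kappa>) +
        b' i * exp (- rate \<beta> k * (n * card (R i) / real n ^ k)))"
    unfolding \<Phi>_def P_def by (simp add: hit_def)
  moreover have "\<Phi> k \<sigma> = (\<Sum>i\<in>E. b i * exp (- \<beta> * card (hit n \<sigma> k (H i))) +
      b' i * exp (- \<beta> * card (agreeing n \<sigma> k (R i))))"
    unfolding \<Phi>_def P_def by simp
  ultimately show thesis using that[of \<sigma>] \<sigma> by simp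
qed


text \<open>
  The weights \<open>b\<close> and \<open>b'\<close> are chosen such that a final term is at least \<open>1\<close> as soon as its number
  falls short of its mean by \<open>x\<close>, while initially every term is at most
  \<open>e^(-\<beta>x + \<beta>^2 W)\<close>. The bound on \<open>card (R i)\<close> makes the same \<open>W\<close> serve both kinds of terms.
\<close>

lemma exists_permutations_hit_and_agreeing_gt:
  fixes H :: "'e \<Rightarrow> nat \<Rightarrow> nat set" and R :: "'e \<Rightarrow> (nat \<Rightarrow> nat) set" and \<beta> x :: real
  assumes fin: "finite E" and n: "0 < n" and k: "0 < k" and beta: "0 \<le> \<beta>" "\<beta> \<le> 1 / 2"
    and H: "\<And>i l. i \<in> E \<Longrightarrow> l \<in> {1..k} \<Longrightarrow> H i l \<subseteq> {1..n} \<and> card (H i l) \<le> s"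
    and R: "\<And>i. i \<in> E \<Longrightarrow> R i \<subseteq> tuples n k"
    and cardR: "\<And>i. i \<in> E \<Longrightarrow> card (R i) / real n ^ (k - 1) \<le> real k * (real (k - 1) * s * s / n)"
    and small: "2 * real (card E) *
      exp (- \<beta> * x + \<beta>\<^sup>2 * (2 * real k * real k * (real (k - 1) * s * s / n))) < 1"
  obtains \<sigma> where "\<forall>l\<in>{1..k}. \<sigma> l permutes {1..n}"
    and "\<forall>i\<in>E. n - n * (\<Prod>l\<in>{1..k}. 1 - card (H i l) / n) - x < card (hit n \<sigma> k (H i))"
    and "\<forall>i\<in>E. card (R i) / real n ^ (k - 1) - x < card (agreeing n \<sigma> k (R i))"
proof -
  define v where "v = real (k - 1) * s * s / n"
  define W where "W = 2 * real k * real k * v"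
  define muH where "muH i = n - n * (\<Prod>l\<in>{1..k}. 1 - real (card (H i l)) / n)" for i
  define muR where "muR i = card (R i) / real n ^ (k - 1)" for i
  define b where "b i = exp (\<beta> * (muH i - x))" for i
  define b' where "b' i = exp (\<beta> * (muR i - x))" for i
  have v0: "0 \<le> v" by (simp add: v_def)
  have muR: "n * card (R i) / real n ^ k = muR i" for i
  proof -
    have "real n ^ k = n * real n ^ (k - 1)" using k by (simp flip: power_Suc)
    then show ?thesis using n by (simp add: muR_def)
  qed
  have b0: "i \<in> E \<Longrightarrow> 0 \<le> b i" "i \<in> E \<Longrightarrow> 0 \<le> b' i" for i
    by (simp_all add: b_def b'_def)
  obtain \<sigma> where \<sigma>: "\<forall>l\<in>{1..k}. \<sigma> l permutes {1..n}"
    and raw: "(\<Sum>i\<in>E. b i * exp (- \<beta> * card (hit n \<sigma> k (H i))) +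
           b' i * exp (- \<beta> * card (agreeing n \<sigma> k (R i)))) \<le>
         (\<Sum>i\<in>E. b i * exp (- \<beta> * (n - n * (\<Prod>l\<in>{1..k}. 1 - card (H i l) / n)) +
             k * (2 * \<beta>\<^sup>2 * (real (k - 1) * s * s / n))) +
           b' i * exp (- rate \<beta> k * (n * card (R i) / real n ^ k)))"
    by (rule exists_permutations_potential_le[OF n beta H R b0])
  have le: "(\<Sum>i\<in>E. b i * exp (- \<beta> * card (hit n \<sigma> k (H i))) +
           b' i * exp (- \<beta> * card (agreeing n \<sigma> k (R i)))) \<le>
         (\<Sum>i\<in>E. b i * exp (- \<beta> * muH i + k * (2 * \<beta>\<^sup>2 * v)) + b' i * exp (- rate \<beta> k * muR i))"
    using raw unfolding muR by (simp only: muH_def v_def)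
  have start: "b i * exp (- \<beta> * muH i + k * (2 * \<beta>\<^sup>2 * v)) + b' i * exp (- rate \<beta> k * muR i) \<le>
      2 * exp (- \<beta> * x + \<beta>\<^sup>2 * W)" if "i \<in> E" for i
  proof -
    have "1 * (2 * k * \<beta>\<^sup>2 * v) \<le> k * (2 * k * \<beta>\<^sup>2 * v)" using k v0 by (intro mult_right_mono) auto
    then have "b i * exp (- \<beta> * muH i + k * (2 * \<beta>\<^sup>2 * v)) \<le> exp (- \<beta> * x + \<beta>\<^sup>2 * W)"
      unfolding b_def W_def exp_add[symmetric] by (simp add: algebra_simps)
    moreover have "b' i * exp (- rate \<beta> k * muR i) \<le> exp (- \<beta> * x + \<beta>\<^sup>2 * W)"
    proof -
      have "(\<beta> - rate \<beta> k) * muR i \<le> (2 * k * \<beta>\<^sup>2) * (k * v)"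
        using rate_bounds[OF beta, of k] cardR[OF that]
        by (intro mult_mono) (auto simp: muR_def v_def)
      then show ?thesis
        unfolding b'_def W_def exp_add[symmetric] by (simp add: algebra_simps)
    qed
    ultimately show ?thesis by simp
  qed
  have "(\<Sum>i\<in>E. b i * exp (- \<beta> * muH i + k * (2 * \<beta>\<^sup>2 * v)) + b' i * exp (- rate \<beta> k * muR i)) \<le>
      (\<Sum>i\<in>E. 2 * exp (- \<beta> * x + \<beta>\<^sup>2 * W))"
    by (intro sum_mono start)
  also have "\<dots> < 1" using small by (simp add: W_def v_def)
  finally have lt1: "(\<Sum>i\<in>E. b i * exp (- \<beta> * card (hit n \<sigma> k (H i))) +
           b' i * exp (- \<beta> * card (agreeing n \<sigma> k (R i)))) < 1"
    using le by linarith
  have "muH i - x < card (hit n \<sigma> k (H i)) \<and> muR i - x < card (agreeing n \<sigma> k (R i))"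
    if i: "i \<in> E" for i
  proof -
    have pos: "0 < b i * exp (- \<beta> * card (hit n \<sigma> k (H i)))"
      "0 < b' i * exp (- \<beta> * card (agreeing n \<sigma> k (R i)))" for i
      by (simp_all add: b_def b'_def)
    have "b i * exp (- \<beta> * card (hit n \<sigma> k (H i))) +
           b' i * exp (- \<beta> * card (agreeing n \<sigma> k (R i))) < 1"
      using member_le_sum[OF i _ fin, of "\<lambda>i. b i * exp (- \<beta> * card (hit n \<sigma> k (H i))) +
           b' i * exp (- \<beta> * card (agreeing n \<sigma> k (R i)))"] pos lt1
      by (smt (verit))
    then have "b i * exp (- \<beta> * card (hit n \<sigma> k (H i))) < 1"
      "b' i * exp (- \<beta> * card (agreeing n \<sigma> k (R i))) < 1"
      using pos[of i] by linarith+
    then have "exp (\<beta> * (muH i - x) - \<beta> * card (hit n \<sigma> k (H i))) < 1"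
      "exp (\<beta> * (muR i - x) - \<beta> * card (agreeing n \<sigma> k (R i))) < 1"
      by (simp_all add: b_def b'_def flip: exp_add)
    then have "\<beta> * (muH i - x - card (hit n \<sigma> k (H i))) < 0"
      "\<beta> * (muR i - x - card (agreeing n \<sigma> k (R i))) < 0"
      by (simp_all add: right_diff_distrib)
    then show ?thesis using beta(1) by (simp add: mult_less_0_iff)
  qed
  then show thesis using that \<sigma> unfolding muH_def muR_def by blast
qed

section \<open>From usable rows to a rainbow matching\<close>

lemma exists_tuple_avoiding:
  fixes R :: "('a \<Rightarrow> 'b) set"
  assumes "finite R" and "finite L"
    and B: "\<And>l. l \<in> L \<Longrightarrow> finite (B l) \<and> card (B l) \<le> q"
    and deg: "\<And>l w. l \<in> L \<Longrightarrow> card {T \<in> R. T l = w} \<le> d"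
    and large: "card L * q * d < card R"
  shows "\<exists>T\<in>R. \<forall>l\<in>L. T l \<notin> B l"
proof (rule ccontr)
  assume "\<not> ?thesis"
  then have "R \<subseteq> (\<Union>l\<in>L. \<Union>w\<in>B l. {T \<in> R. T l = w})" by blast
  then have "card R \<le> card (\<Union>l\<in>L. \<Union>w\<in>B l. {T \<in> R. T l = w})"
    using assms by (intro card_mono) auto
  also have "\<dots> \<le> (\<Sum>l\<in>L. card (\<Union>w\<in>B l. {T \<in> R. T l = w}))"
    by (rule card_UN_le[OF \<open>finite L\<close>])
  also have "\<dots> \<le> (\<Sum>l\<in>L. q * d)"
  proof (rule sum_mono)
    fix l assume l: "l \<in> L"
    have "card (\<Union>w\<in>B l. {T \<in> R. T l = w}) \<le> (\<Sum>w\<in>B l. card {T \<in> R. T l = w})"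
      using B[OF l] by (intro card_UN_le) simp
    also have "\<dots> \<le> (\<Sum>w\<in>B l. d)" by (intro sum_mono deg l)
    also have "\<dots> \<le> q * d" using B[OF l] by simp
    finally show "card (\<Union>w\<in>B l. {T \<in> R. T l = w}) \<le> q * d" .
  qed
  finally show False using large by (simp add: mult.assoc)
qed

text \<open>
  Fixing one further coordinate leaves at most \<open>n^(k-2)\<close> tuples through the value \<open>v\<close>, and only
  the \<open>k-1\<close> other coordinates can cause a conflict.
\<close>

lemma exists_tuple_through_heavy:
  assumes F: "F \<subseteq> tuples n k" and l: "l \<in> {1..k}"
    and heavy: "(k - 1) * q * n ^ (k - 2) < card {T \<in> F. T l = v}"
    and B: "\<And>l. l \<in> {1..k} \<Longrightarrow> finite (B l) \<and> card (B l) \<le> q"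
    and v: "v \<notin> B l"
  shows "\<exists>T\<in>F. T l = v \<and> (\<forall>l'\<in>{1..k}. T l' \<notin> B l')"
proof -
  have "\<exists>T\<in>{T \<in> F. T l = v}. \<forall>l'\<in>{1..k} - {l}. T l' \<notin> B l'"
  proof (rule exists_tuple_avoiding)
    show "finite {T \<in> F. T l = v}" using F finite_tuples finite_subset by fastforce
    show "card ({1..k} - {l}) * q * n ^ (k - 2) < card {T \<in> F. T l = v}" using heavy l by simp
  next
    fix l' w assume l': "l' \<in> {1..k} - {l}"
    have "card {T \<in> {T \<in> F. T l = v}. T l' = w} \<le>
        card {T \<in> tuples n k. \<forall>m\<in>{l, l'}. T m = (if m = l then v else w)}"
      using F l' by (intro card_mono) (auto simp: finite_tuples)
    also have "\<dots> \<le> n ^ (k - card {l, l'})" using l l' by (intro card_tuples_fixed_le) auto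
    also have "card {l, l'} = 2" using l' by simp
    finally show "card {T \<in> {T \<in> F. T l = v}. T l' = w} \<le> n ^ (k - 2)" .
  qed (use B in auto)
  then show ?thesis using v by blast
qed

text \<open>
  The sets \<open>P i l\<close> hold the value that family \<open>i\<close> has reserved in coordinate \<open>l\<close>, if any. The
  reservations are replaced by full tuples one family at a time. While family \<open>i\<close> is treated, every
  other family occupies at most one value per coordinate, through its tuple or its reservation, so the
  forbidden sets \<open>B l\<close> have at most \<open>card S - 1\<close> elements.
\<close>

lemma exists_completion:
  fixes P :: "'e \<Rightarrow> nat \<Rightarrow> nat set" and F :: "'e \<Rightarrow> (nat \<Rightarrow> nat) set"
  assumes fin: "finite S"
    and disj: "\<And>i j l. i \<in> S \<Longrightarrow> j \<in> S \<Longrightarrow> i \<noteq> j \<Longrightarrow> l \<in> {1..k} \<Longrightarrow> P i l \<inter> P j l = {}"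
    and card: "\<And>i l. i \<in> S \<Longrightarrow> finite (P i l) \<and> card (P i l) \<le> 1"
    and completable: "\<And>i B. i \<in> S \<Longrightarrow>
      (\<And>l. l \<in> {1..k} \<Longrightarrow> finite (B l) \<and> card (B l) \<le> card S - 1 \<and> B l \<inter> P i l = {}) \<Longrightarrow>
      \<exists>T\<in>F i. \<forall>l\<in>{1..k}. P i l \<subseteq> {T l} \<and> T l \<notin> B l"
  shows "\<exists>T. (\<forall>i\<in>S. T i \<in> F i) \<and> pairwise (\<lambda>i j. disjoint_tuples k (T i) (T j)) S"
proof -
  define Q where "Q D T i l = (if i \<in> D then {T i l} else P i l)"
    for D and T :: "'e \<Rightarrow> nat \<Rightarrow> nat" and i l
  have "\<exists>T. (\<forall>i\<in>D. T i \<in> F i) \<and>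
      (\<forall>i\<in>S. \<forall>j\<in>S. \<forall>l\<in>{1..k}. i \<noteq> j \<longrightarrow> Q D T i l \<inter> Q D T j l = {})" if "D \<subseteq> S" for D
    using finite_subset[OF that fin] that
  proof (induction D rule: finite_induct)
    case empty
    then show ?case using disj by (simp add: Q_def)
  next
    case (insert i D)
    then obtain T where T: "\<forall>i\<in>D. T i \<in> F i"
      and QT: "\<forall>i\<in>S. \<forall>j\<in>S. \<forall>l\<in>{1..k}. i \<noteq> j \<longrightarrow> Q D T i l \<inter> Q D T j l = {}"
      by auto
    have i: "i \<in> S" using insert.prems by simp
    define B where "B l = (\<Union>j\<in>S - {i}. Q D T j l)" for l
    have Q1: "finite (Q D T j l) \<and> card (Q D T j l) \<le> 1" if "j \<in> S" for j l
      using card[OF that] by (simp add: Q_def)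
    have "finite (B l) \<and> card (B l) \<le> card S - 1 \<and> B l \<inter> P i l = {}" if l: "l \<in> {1..k}" for l
    proof (intro conjI)
      show "finite (B l)" unfolding B_def using fin Q1 by blast
      have "card (B l) \<le> (\<Sum>j\<in>S - {i}. card (Q D T j l))"
        unfolding B_def using fin by (intro card_UN_le) simp
      also have "\<dots> \<le> (\<Sum>j\<in>S - {i}. 1)" using Q1 by (intro sum_mono) auto
      finally show "card (B l) \<le> card S - 1" using fin i by simp
      have "Q D T i l = P i l" using insert.hyps by (simp add: Q_def)
      then show "B l \<inter> P i l = {}" unfolding B_def using QT i l by blast
    qed
    from completable[OF i this] obtain t where t: "t \<in> F i"
      "\<forall>l\<in>{1..k}. P i l \<subseteq> {t l} \<and> t l \<notin> B l" by blast
    have Qi: "Q (insert i D) (T(i := t)) i l = {t l}" for l by (simp add: Q_def)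
    have Qj: "Q (insert i D) (T(i := t)) j l = Q D T j l" if "j \<noteq> i" for j l
      using that by (simp add: Q_def)
    have "\<forall>j\<in>S. \<forall>j'\<in>S. \<forall>l\<in>{1..k}. j \<noteq> j' \<longrightarrow>
        Q (insert i D) (T(i := t)) j l \<inter> Q (insert i D) (T(i := t)) j' l = {}"
    proof (intro ballI impI)
      fix j j' l assume j: "j \<in> S" "j' \<in> S" "l \<in> {1..k}" "j \<noteq> j'"
      consider "j = i" | "j' = i" | "j \<noteq> i" "j' \<noteq> i" by blast
      then show "Q (insert i D) (T(i := t)) j l \<inter> Q (insert i D) (T(i := t)) j' l = {}"
      proof cases
        case 1
        then show ?thesis using t(2) j Qi Qj[of j'] by (auto simp: B_def)
      next
        case 2
        then show ?thesis using t(2) j Qi Qj[of j] by (auto simp: B_def)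
      next
        case 3
        then show ?thesis using QT j Qj by simp
      qed
    qed
    moreover have "\<forall>j\<in>insert i D. (T(i := t)) j \<in> F j" using T t(1) by simp
    ultimately show ?case by blast
  qed
  from this[of S] obtain T where T: "\<forall>i\<in>S. T i \<in> F i"
    and "\<forall>i\<in>S. \<forall>j\<in>S. \<forall>l\<in>{1..k}. i \<noteq> j \<longrightarrow> Q S T i l \<inter> Q S T j l = {}" by auto
  then have "pairwise (\<lambda>i j. disjoint_tuples k (T i) (T j)) S"
    by (auto simp: pairwise_def disjoint_tuples_def Q_def)
  then show ?thesis using T by blast
qed

lemma distinct_representatives_of_growing:
  assumes "\<And>i. i \<in> {1..m} \<Longrightarrow> finite (A i) \<and> i \<le> card (A i)"
  shows "\<exists>r. (\<forall>i\<in>{1..m}. r i \<in> A i) \<and> inj_on r {1..m}"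
  using assms
proof (induction m)
  case 0
  then show ?case by simp
next
  case (Suc m)
  have "finite (A i) \<and> i \<le> card (A i)" if "i \<in> {1..m}" for i
    using that by (intro Suc.prems) simp
  from Suc.IH[OF this] obtain r where r: "\<forall>i\<in>{1..m}. r i \<in> A i" "inj_on r {1..m}" by blast
  have "card (r ` {1..m}) \<le> m" using card_image_le[of "{1..m}" r] by simp
  also have "m < card (A (Suc m))" using Suc.prems[of "Suc m"] by simp
  finally have "\<not> A (Suc m) \<subseteq> r ` {1..m}" using card_mono[of "r ` {1..m}" "A (Suc m)"] by auto
  then obtain x where x: "x \<in> A (Suc m)" "x \<notin> r ` {1..m}" by blast
  define r' where "r' = r(Suc m := x)"
  have Suc_m: "{1..Suc m} = insert (Suc m) {1..m}" by auto
  have "\<forall>i\<in>{1..Suc m}. r' i \<in> A i" unfolding Suc_m using r(1) x(1) by (simp add: r'_def)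
  moreover have "inj_on r' {1..Suc m}"
  proof -
    have "r' ` {1..m} = r ` {1..m}" by (intro image_cong) (simp_all add: r'_def)
    then have "r' (Suc m) \<notin> r' ` ({1..m} - {Suc m})" using x(2) by (simp add: r'_def)
    moreover have "inj_on r' {1..m}" unfolding r'_def using r(2) x(2) by (rule inj_on_fun_updI)
    ultimately show ?thesis unfolding Suc_m inj_on_insert by blast
  qed
  ultimately show ?case by blast
qed

definition heavy :: "nat \<Rightarrow> (nat \<Rightarrow> nat) set \<Rightarrow> nat \<Rightarrow> nat \<Rightarrow> nat set" where
  "heavy n F d l = {v \<in> {1..n}. d < card {T \<in> F. T l = v}}"

definition light_part :: "nat \<Rightarrow> nat \<Rightarrow> (nat \<Rightarrow> nat) set \<Rightarrow> nat \<Rightarrow> (nat \<Rightarrow> nat) set" where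
  "light_part n k F d = {T \<in> F. \<forall>l\<in>{1..k}. T l \<notin> heavy n F d l}"

text \<open>
  The rows that can serve \<open>F\<close>: a row with a heavy value provides a reservation, a row in the light
  part provides a tuple. The two kinds are disjoint.
\<close>

definition usable :: "nat \<Rightarrow> nat \<Rightarrow> (nat \<Rightarrow> nat \<Rightarrow> nat) \<Rightarrow> (nat \<Rightarrow> nat) set \<Rightarrow> nat \<Rightarrow> nat set" where
  "usable n k \<sigma> F d = hit n \<sigma> k (heavy n F d) \<union>
     {r \<in> {1..n}. restrict (\<lambda>l. \<sigma> l r) {1..k} \<in> light_part n k F d}"

text \<open>
  Families with a big light part reserve nothing. Each of the others gets its own usable row, and
  reserves either the whole row or one heavy value in it. For the greedy choice of distinct rows it
  is convenient to let the families with a big light part take part with all rows allowed.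
\<close>

lemma rainbow_matching_of_usable:
  fixes F :: "nat \<Rightarrow> (nat \<Rightarrow> nat) set" and n s k :: nat
  defines "d \<equiv> (k - 1) * (s - 1) * n ^ (k - 2)"
  assumes s: "s \<le> n"
    and F: "\<And>i. i \<in> {1..s} \<Longrightarrow> F i \<subseteq> tuples n k"
    and \<sigma>: "\<And>l. l \<in> {1..k} \<Longrightarrow> \<sigma> l permutes {1..n}"
    and usable: "\<And>i. i \<in> {1..s} \<Longrightarrow> card (light_part n k (F i) d) \<le> k * (s - 1) * d \<Longrightarrow>
      i \<le> card (usable n k \<sigma> (F i) d)"
  shows "\<exists>T. (\<forall>i\<in>{1..s}. T i \<in> F i) \<and> pairwise (\<lambda>i j. disjoint_tuples k (T i) (T j)) {1..s}"
proof -
  define big where "big i \<longleftrightarrow> k * (s - 1) * d < card (light_part n k (F i) d)" for i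
  define A where "A i = (if big i then {1..n} else usable n k \<sigma> (F i) d)" for i
  have An: "A i \<subseteq> {1..n}" for i by (auto simp: A_def usable_def hit_def)
  have "finite (A i) \<and> i \<le> card (A i)" if "i \<in> {1..s}" for i
    using usable[OF that] s that finite_subset[OF An] by (auto simp: A_def big_def not_less)
  then obtain r where r: "\<forall>i\<in>{1..s}. r i \<in> A i" "inj_on r {1..s}"
    using distinct_representatives_of_growing[of s A] by blast
  define m where "m i = restrict (\<lambda>l. \<sigma> l (r i)) {1..k}" for i
  define c where "c i = (SOME l. l \<in> {1..k} \<and> \<sigma> l (r i) \<in> heavy n (F i) d l)" for i
  have c: "c i \<in> {1..k} \<and> \<sigma> (c i) (r i) \<in> heavy n (F i) d (c i)"
    if "i \<in> {1..s}" "\<not> big i" "m i \<notin> light_part n k (F i) d" for i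
  proof -
    have "r i \<in> A i" using r(1) that(1) by blast
    then have "r i \<in> usable n k \<sigma> (F i) d" using that(2) by (simp add: A_def)
    then have "\<exists>l. l \<in> {1..k} \<and> \<sigma> l (r i) \<in> heavy n (F i) d l"
      using that(3) by (auto simp: usable_def hit_def m_def)
    then show ?thesis unfolding c_def by (rule someI_ex)
  qed
  define P where "P i l = (if big i then {} else if m i \<in> light_part n k (F i) d \<or> l = c i
    then {\<sigma> l (r i)} else {})" for i l
  have P: "P i l \<subseteq> {\<sigma> l (r i)}" for i l by (auto simp: P_def)
  show ?thesis
  proof (rule exists_completion[where P = P])
    fix i j l assume i: "i \<in> {1..s}" and j: "j \<in> {1..s}" and "i \<noteq> j" and l: "l \<in> {1..k}"
    then have "r i \<noteq> r j" by (metis inj_onD r(2))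
    then have "\<sigma> l (r i) \<noteq> \<sigma> l (r j)"
      using permutes_inj[OF \<sigma>[OF l]] by (simp add: inj_eq)
    then show "P i l \<inter> P j l = {}" using P[of i l] P[of j l] by blast
  next
    fix i l
    show "finite (P i l) \<and> card (P i l) \<le> 1" by (simp add: P_def)
  next
    fix i and B :: "nat \<Rightarrow> nat set"
    assume i: "i \<in> {1..s}" and
      "\<And>l. l \<in> {1..k} \<Longrightarrow> finite (B l) \<and> card (B l) \<le> card {1..s} - 1 \<and> B l \<inter> P i l = {}"
    then have B: "finite (B l) \<and> card (B l) \<le> s - 1" and BP: "B l \<inter> P i l = {}"
      if "l \<in> {1..k}" for l
      using that by auto
    have finF: "finite (F i)" using F[OF i] finite_tuples finite_subset by blast
    consider (big) "big i" | (light) "\<not> big i" "m i \<in> light_part n k (F i) d"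
      | (heavy) "\<not> big i" "m i \<notin> light_part n k (F i) d" by blast
    then show "\<exists>T\<in>F i. \<forall>l\<in>{1..k}. P i l \<subseteq> {T l} \<and> T l \<notin> B l"
    proof cases
      case big
      let ?R = "light_part n k (F i) d"
      have RF: "?R \<subseteq> F i" by (auto simp: light_part_def)
      have "\<exists>T\<in>?R. \<forall>l\<in>{1..k}. T l \<notin> B l"
      proof (rule exists_tuple_avoiding)
        show "finite ?R" using finF RF finite_subset by blast
        show "card {1..k} * (s - 1) * d < card ?R" using big by (simp add: big_def)
      next
        fix l w assume l: "l \<in> {1..k}"
        show "card {T \<in> ?R. T l = w} \<le> d"
        proof (cases "{T \<in> ?R. T l = w} = {}")
          case True
          then show ?thesis by (simp only: card.empty)
        next
          case False
          then obtain T where T: "T \<in> F i" "T l = w" "T l \<notin> heavy n (F i) d l"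
            using l by (auto simp: light_part_def)
          have "w \<in> {1..n}" using T(1,2) F[OF i] l unfolding tuples_def by fastforce
          then have "card {T \<in> F i. T l = w} \<le> d" using T(2,3) by (auto simp: heavy_def not_less)
          moreover have "card {T \<in> ?R. T l = w} \<le> card {T \<in> F i. T l = w}"
            using finF RF by (intro card_mono) auto
          ultimately show ?thesis by simp
        qed
      qed (use B in auto)
      then show ?thesis using RF big by (auto simp: P_def)
    next
      case light
      then have P': "P i l = {\<sigma> l (r i)}" for l by (simp add: P_def)
      have "m i \<in> F i" using light by (simp add: light_part_def)
      moreover have "P i l \<subseteq> {m i l} \<and> m i l \<notin> B l" if "l \<in> {1..k}" for l
        using BP[OF that] that P'[of l] unfolding m_def by auto
      ultimately show ?thesis by blast
    next
      case heavy
      note ci = c[OF i heavy]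
      have "\<sigma> (c i) (r i) \<notin> B (c i)" using BP[of "c i"] ci heavy by (auto simp: P_def)
      moreover have "d < card {T \<in> F i. T (c i) = \<sigma> (c i) (r i)}"
        using ci by (simp add: heavy_def)
      ultimately obtain T where "T \<in> F i" "T (c i) = \<sigma> (c i) (r i)" "\<forall>l\<in>{1..k}. T l \<notin> B l"
        using exists_tuple_through_heavy[OF F[OF i], of "c i" "s - 1" "\<sigma> (c i) (r i)" B] ci B
        unfolding d_def by blast
      then show ?thesis using heavy by (intro bexI[of _ T]) (auto simp: P_def)
    qed
  qed simp
qed

text \<open>
  The expected number of usable rows is at least the scaled size of the family: a tuple with a heavy
  value is one of the \<open>n^k - (\<Prod>l\<in>{1..k}. n - h l)\<close> tuples of the grid that meet the heavy
  values, where \<open>h l\<close> is their number in coordinate \<open>l\<close>.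
\<close>

lemma card_le_hit_plus_light:
  assumes F: "F \<subseteq> tuples n k" and n: "0 < n" and k: "0 < k"
  shows "card F / real n ^ (k - 1) \<le>
    n - n * (\<Prod>l\<in>{1..k}. 1 - card (heavy n F d l) / n) + card (light_part n k F d) / real n ^ (k - 1)"
proof -
  let ?N = "{1..k} \<rightarrow>\<^sub>E {1..n}" and ?C = "PiE {1..k} (\<lambda>l. {1..n} - heavy n F d l)"
  let ?R = "light_part n k F d"
  have finF: "finite F" using F finite_tuples finite_subset by blast
  have sub: "heavy n F d l \<subseteq> {1..n}" for l by (auto simp: heavy_def)
  have CN: "?C \<subseteq> ?N" by (intro PiE_mono) auto
  have "F \<subseteq> (?N - ?C) \<union> ?R"
  proof
    fix T assume T: "T \<in> F"
    then have "T \<in> ?N" using F by (auto simp: tuples_def)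
    then show "T \<in> (?N - ?C) \<union> ?R" using T by (auto simp: light_part_def PiE_iff)
  qed
  then have "card F \<le> card ((?N - ?C) \<union> ?R)"
    using finF by (intro card_mono) (auto simp: finite_PiE light_part_def)
  also have "\<dots> \<le> card (?N - ?C) + card ?R" by (rule card_Un_le)
  finally have "real (card F) \<le> real (card (?N - ?C)) + real (card ?R)" by linarith
  moreover have "real (card (?N - ?C)) = real (card ?N) - real (card ?C)"
    using CN by (simp add: card_Diff_subset finite_subset finite_PiE card_mono of_nat_diff)
  moreover have "real (card ?N) = real n ^ k" by (simp add: card_PiE)
  moreover have "real (card ?C) = real n ^ k * (\<Prod>l\<in>{1..k}. 1 - card (heavy n F d l) / n)"
  proof -
    have "card ?C = (\<Prod>l\<in>{1..k}. card ({1..n} - heavy n F d l))" by (simp add: card_PiE)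
    then have "real (card ?C) = (\<Prod>l\<in>{1..k}. real (card ({1..n} - heavy n F d l)))" by simp
    also have "\<dots> = (\<Prod>l\<in>{1..k}. n * (1 - card (heavy n F d l) / n))"
    proof (intro prod.cong refl)
      fix l
      have "card (heavy n F d l) \<le> n" using card_mono[OF _ sub[of l]] by simp
      then show "real (card ({1..n} - heavy n F d l)) = n * (1 - card (heavy n F d l) / n)"
        using sub[of l] n
        by (simp add: card_Diff_subset finite_subset of_nat_diff right_diff_distrib)
    qed
    finally show ?thesis by (simp add: prod.distrib)
  qed
  ultimately have "real (card F) \<le>
      real n ^ k - real n ^ k * (\<Prod>l\<in>{1..k}. 1 - card (heavy n F d l) / n) + real (card ?R)"
    by linarith
  moreover have "real n ^ k = n * real n ^ (k - 1)" using k by (simp flip: power_Suc)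
  ultimately have "real (card F) \<le> (n - n * (\<Prod>l\<in>{1..k}. 1 - card (heavy n F d l) / n)) *
      real n ^ (k - 1) + real (card ?R)"
    by (simp add: algebra_simps)
  then have "card F / real n ^ (k - 1) \<le> ((n - n * (\<Prod>l\<in>{1..k}. 1 - card (heavy n F d l) / n)) *
      real n ^ (k - 1) + real (card ?R)) / real n ^ (k - 1)"
    by (intro divide_right_mono) auto
  also have "\<dots> = n - n * (\<Prod>l\<in>{1..k}. 1 - card (heavy n F d l) / n) + card ?R / real n ^ (k - 1)"
    using n by (simp add: add_divide_distrib)
  finally show ?thesis .
qed

lemma hit_plus_agreeing_le_usable:
  "card (hit n \<sigma> k (heavy n F d)) + card (agreeing n \<sigma> k (light_part n k F d))
    \<le> card (usable n k \<sigma> F d)" if F: "F \<subseteq> tuples n k"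
proof -
  let ?R = "light_part n k F d"
  let ?L = "{r \<in> {1..n}. restrict (\<lambda>l. \<sigma> l r) {1..k} \<in> ?R}"
  have T: "T = restrict (\<lambda>l. \<sigma> l r) {1..k}" if "(r, T) \<in> agreeing n \<sigma> k ?R" for r T
  proof
    fix l
    show "T l = restrict (\<lambda>l. \<sigma> l r) {1..k} l"
      using that F PiE_arb unfolding agreeing_def light_part_def tuples_def by fastforce
  qed
  have "card (agreeing n \<sigma> k ?R) \<le> card ?L"
  proof (rule card_inj_on_le)
    show "inj_on fst (agreeing n \<sigma> k ?R)" by (rule inj_onI) (metis T prod.collapse)
    show "fst ` agreeing n \<sigma> k ?R \<subseteq> ?L"
    proof
      fix r assume "r \<in> fst ` agreeing n \<sigma> k ?R"
      then obtain T where rT: "(r, T) \<in> agreeing n \<sigma> k ?R" by auto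
      then show "r \<in> ?L" using T[OF rT] by (simp add: agreeing_def)
    qed
  qed simp
  moreover have "hit n \<sigma> k (heavy n F d) \<inter> ?L = {}"
    by (auto simp: hit_def light_part_def)
  then have "card (usable n k \<sigma> F d) = card (hit n \<sigma> k (heavy n F d)) + card ?L"
    unfolding usable_def by (intro card_Un_disjoint) (auto simp: hit_def)
  ultimately show ?thesis by simp
qed

section \<open>Concentration of the number of usable rows\<close>

text \<open>
  If \<open>x < W\<close>, then \<open>-\<beta>x + \<beta>^2 W\<close> is minimal at \<open>\<beta> = x / (2W) < 1/2\<close>, where it equals
  \<open>-x^2 / (4W)\<close>; the first lower bound on \<open>x\<close> makes this less than \<open>-L\<close>, because \<open>4(k-1) \<le> k^2\<close>. If \<open>W \<le> x\<close>,
  then the best \<open>\<beta>\<close> within the limit \<open>1/2\<close> of the moment bound is \<open>1/2\<close> itself, where the exponent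
  is at most \<open>-x/4\<close>, and the second lower bound applies.
\<close>

lemma exists_exponent_beating_union_bound:
  fixes n s k :: nat and x L W :: real
  defines "L \<equiv> ln (2 * real k * real s)"
    and "W \<equiv> 2 * real k * real k * (real (k - 1) * s * s / n)"
  assumes n: "0 < n" and s: "0 < s" and k: "0 < k"
    and x1: "real k ^ 2 * s / sqrt n * sqrt (8 * L) / 2 < x" and x2: "4 * real k * L < x"
  obtains \<beta> where "0 \<le> \<beta>" and "\<beta> \<le> 1 / 2" and "- \<beta> * x + \<beta>\<^sup>2 * W < - L"
proof -
  have ks: "1 \<le> k * s" using s k by simp
  then have "2 \<le> 2 * real k * real s" by (simp flip: of_nat_mult)
  then have L: "0 < L" unfolding L_def by simp
  have k1: "1 \<le> real k" using k by simp
  have "0 < 4 * real k * L" using k L by simp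
  then have x0: "0 < x" using x2 by linarith
  have W0: "0 \<le> W" by (simp add: W_def)
  show thesis
  proof (cases "W \<le> x")
    case True
    have "L * 1 \<le> L * k" using L k1 by (intro mult_left_mono) auto
    then have "- (1 / 2) * x + (1 / 2)\<^sup>2 * W < - L"
      using True x2 by (simp add: power2_eq_square algebra_simps)
    then show thesis by (intro that[of "1 / 2"]) auto
  next
    case False
    then have Wpos: "0 < W" using x0 by linarith
    have "(real k ^ 2 * s / sqrt n * sqrt (8 * L) / 2)\<^sup>2 < x\<^sup>2"
      using x1 L by (intro power_strict_mono) auto
    moreover have "(real k ^ 2 * s / sqrt n * sqrt (8 * L) / 2)\<^sup>2 = 2 * real k ^ 4 * real s ^ 2 * L / n"
      using L by (simp add: power_mult_distrib power_divide real_sqrt_pow2 flip: power_mult)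
    ultimately have x2W: "2 * real k ^ 4 * real s ^ 2 * L / n < x\<^sup>2" by simp
    have "4 * (real k - 1) \<le> real k * real k"
      using zero_le_square[of "real k - 2"] by (simp add: algebra_simps)
    then have "(4 * (real k - 1)) * (2 * (real k * real k) * (real s ^ 2 * L / n)) \<le>
        (real k * real k) * (2 * (real k * real k) * (real s ^ 2 * L / n))"
      using L by (intro mult_right_mono) auto
    then have "4 * L * W \<le> 2 * real k ^ 4 * real s ^ 2 * L / n"
      using k by (simp add: W_def of_nat_diff power4_eq_xxxx power2_eq_square mult_ac)
    then have "4 * L * W < x\<^sup>2" using x2W by linarith
    then have "L < x\<^sup>2 / (4 * W)" using Wpos by (simp add: field_simps)
    moreover have "- (x / (2 * W)) * x + (x / (2 * W))\<^sup>2 * W = - (x\<^sup>2 / (4 * W))"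
      using Wpos by (simp add: field_simps power2_eq_square)
    moreover have "x / (2 * W) \<le> 1 / 2" "0 \<le> x / (2 * W)"
      using False Wpos x0 by (simp_all add: field_simps)
    ultimately show thesis by (intro that[of "x / (2 * W)"]) auto
  qed
qed

text \<open>
  The hypothesis on the size of \<open>F i\<close> allows the rows with heavy values and the rows in the light part
  to fall short of their means by \<open>x\<close> each. The union bound runs over the set \<open>E\<close> of the families
  with a small light part and at most \<open>s\<close> heavy values in every coordinate.
\<close>

lemma exists_permutations_with_many_usable_rows:
  fixes F :: "nat \<Rightarrow> (nat \<Rightarrow> nat) set" and n s k :: nat and x L :: real and d :: nat
  defines "L \<equiv> ln (2 * real k * real s)" and "d \<equiv> (k - 1) * (s - 1) * n ^ (k - 2)"
  assumes n: "0 < n" and s: "0 < s" and k: "0 < k"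
    and x1: "real k ^ 2 * s / sqrt n * sqrt (8 * L) / 2 < x" and x2: "4 * real k * L < x"
    and F: "\<And>i. i \<in> {1..s} \<Longrightarrow> F i \<subseteq> tuples n k"
    and cardF: "\<And>i. i \<in> {1..s} \<Longrightarrow> real i - 1 + 2 * x < card (F i) / real n ^ (k - 1)"
  obtains \<sigma> where "\<forall>l\<in>{1..k}. \<sigma> l permutes {1..n}"
    and "\<forall>i\<in>{1..s}. card (light_part n k (F i) d) \<le> k * (s - 1) * d \<longrightarrow>
      i \<le> card (usable n k \<sigma> (F i) d)"
proof -
  define v where "v = real (k - 1) * s * s / n"
  obtain \<beta> where beta: "0 \<le> \<beta>" "\<beta> \<le> 1 / 2"
    and small: "- \<beta> * x + \<beta>\<^sup>2 * (2 * real k * real k * v) < - L"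
    using exists_exponent_beating_union_bound[OF n s k] x1 x2 unfolding L_def v_def by blast
  define E where "E = {i \<in> {1..s}. card (light_part n k (F i) d) \<le> k * (s - 1) * d \<and>
    (\<forall>l\<in>{1..k}. card (heavy n (F i) d l) \<le> s)}"
  have E: "finite E" "E \<subseteq> {1..s}" by (auto simp: E_def)
  have heavy_le: "heavy n (F i) d l \<subseteq> {1..n} \<and> card (heavy n (F i) d l) \<le> s"
    if "i \<in> E" "l \<in> {1..k}" for i l
    using that by (auto simp: E_def heavy_def)
  have light_sub: "light_part n k (F i) d \<subseteq> tuples n k" if "i \<in> E" for i
    using that F E(2) by (fastforce simp: light_part_def)
  have light_le: "card (light_part n k (F i) d) / real n ^ (k - 1) \<le> real k * v" if "i \<in> E" for i
  proof (cases "k = 1")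
    case True
    (* Here k - 2 is truncated, and the factor k - 1 makes d vanish. *)
    then show ?thesis using that by (simp add: E_def d_def v_def)
  next
    case False
    have "card (light_part n k (F i) d) \<le> k * (s - 1) * d" using that by (simp add: E_def)
    also have "\<dots> = k * (k - 1) * ((s - 1) * (s - 1)) * n ^ (k - 2)" by (simp add: d_def mult_ac)
    also have "\<dots> \<le> k * (k - 1) * (s * s) * n ^ (k - 2)" by (intro mult_mono) auto
    finally have "real (card (light_part n k (F i) d)) \<le> real (k * (k - 1) * (s * s) * n ^ (k - 2))"
      by (simp only: of_nat_le_iff)
    moreover have "k - 1 = Suc (k - 2)" using False k by simp
    ultimately show ?thesis using n by (simp add: v_def field_simps)
  qed
  have union_bound: "2 * real (card E) * exp (- \<beta> * x + \<beta>\<^sup>2 * (2 * real k * real k * v)) < 1"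
  proof -
    have "card E \<le> s" using card_mono[OF _ E(2)] by simp
    then have "2 * real (card E) * exp (- \<beta> * x + \<beta>\<^sup>2 * (2 * real k * real k * v)) \<le>
        2 * real s * exp (- \<beta> * x + \<beta>\<^sup>2 * (2 * real k * real k * v))"
      by (intro mult_right_mono) auto
    also have "\<dots> < 2 * real s * exp (- L)"
      using small s by (intro mult_strict_left_mono) auto
    also have "\<dots> = 1 / k" using s k by (simp add: L_def exp_minus field_simps)
    also have "\<dots> \<le> 1" using k by simp
    finally show ?thesis .
  qed
  obtain \<sigma> where \<sigma>: "\<forall>l\<in>{1..k}. \<sigma> l permutes {1..n}"
    and hits: "\<forall>i\<in>E. n - n * (\<Prod>l\<in>{1..k}. 1 - card (heavy n (F i) d l) / n) - x <
      card (hit n \<sigma> k (heavy n (F i) d))"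
    and agrees: "\<forall>i\<in>E. card (light_part n k (F i) d) / real n ^ (k - 1) - x <
      card (agreeing n \<sigma> k (light_part n k (F i) d))"
    by (rule exists_permutations_hit_and_agreeing_gt[OF E(1) n k beta heavy_le light_sub
          light_le[unfolded v_def] union_bound[unfolded v_def]])
  have "i \<le> card (usable n k \<sigma> (F i) d)"
    if i: "i \<in> {1..s}" and light: "card (light_part n k (F i) d) \<le> k * (s - 1) * d" for i
  proof (cases "i \<in> E")
    case True
    let ?g = "real n - n * (\<Prod>l\<in>{1..k}. 1 - card (heavy n (F i) d l) / n)"
    let ?r = "card (light_part n k (F i) d) / real n ^ (k - 1)"
    have "real i - 1 + 2 * x < ?g + ?r"
      using cardF[OF i] card_le_hit_plus_light[OF F[OF i] n k, of d] by linarith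
    then have "real i - 1 < (?g - x) + (?r - x)" by linarith
    also have "\<dots> < real (card (hit n \<sigma> k (heavy n (F i) d))) +
        real (card (agreeing n \<sigma> k (light_part n k (F i) d)))"
      using hits agrees True by (intro add_strict_mono) auto
    also have "\<dots> \<le> real (card (usable n k \<sigma> (F i) d))"
      using hit_plus_agreeing_le_usable[OF F[OF i], of \<sigma> d] by linarith
    finally show ?thesis by linarith
  next
    case False
    (* More than s heavy values in a single coordinate l: they lie in pairwise distinct rows. *)
    then obtain l where l: "l \<in> {1..k}" "s < card (heavy n (F i) d l)"
      using i light by (auto simp: E_def)
    have "i \<le> card (heavy n (F i) d l)" using i l(2) by simp
    also have "\<dots> = card {r \<in> {1..n}. \<sigma> l r \<in> heavy n (F i) d l}"
      using \<sigma> l(1) by (intro card_permutes_vimage[symmetric]) (auto simp: heavy_def)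
    also have "\<dots> \<le> card (usable n k \<sigma> (F i) d)"
      using l(1) by (intro card_mono) (auto simp: usable_def hit_def)
    finally show ?thesis .
  qed
  then show thesis using that \<sigma> by blast
qed

theorem theorem1p4:
  fixes n s k :: nat and c :: real
  assumes "n > 0" and "s > 0" and "k > 0" and "n > s"
    and "c \<ge> real n ^ (k - 1) +
           max (real k ^ 2 * real s * real n powr (real k - 3 / 2) * sqrt (8 * ln (2 * real k * real s)))
               (8 * real k * real n ^ (k - 1) * ln (2 * real k * real s))"
  shows "satisfying n s k (\<lambda>i. (real i - 1) * real n ^ (k - 1) + c)"
  unfolding satisfying_def
proof (intro allI impI)
  fix F :: "nat \<Rightarrow> (nat \<Rightarrow> nat) set"
  assume "\<forall>i\<in>{1..s}. F i \<subseteq> tuples n k \<and> real (card (F i)) > (real i - 1) * real n ^ (k - 1) + c"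
  then have F: "F i \<subseteq> tuples n k"
    and cardF: "(real i - 1) * real n ^ (k - 1) + c < card (F i)" if "i \<in> {1..s}" for i
    using that by auto
  define L where "L = ln (2 * real k * real s)"
  define N where "N = real n ^ (k - 1)"
  (* Half of the surplus pays for the heavy part of the deviation, half for the light part. *)
  define x where "x = c / N / 2"
  have N: "0 < N" using assms by (simp add: N_def)
  have powr: "n powr (real k - 3 / 2) = N / sqrt n"
  proof -
    have "real k - 3 / 2 = real (k - 1) - 1 / 2" using assms by (simp add: of_nat_diff)
    then have "n powr (real k - 3 / 2) = n powr real (k - 1) / n powr (1 / 2)"
      by (simp only: powr_diff)
    also have "n powr real (k - 1) = N" using assms(1) by (simp only: powr_realpow N_def of_nat_0_less_iff)
    also have "n powr (1 / 2) = sqrt n" by (simp add: powr_half_sqrt)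
    finally show ?thesis .
  qed
  have half: "y / 2 < z / 2" if "1 + y \<le> z" for y z :: real using that by simp
  have x1: "real k ^ 2 * s / sqrt n * sqrt (8 * L) / 2 < x"
  proof -
    have "N + real k ^ 2 * s * (N / sqrt n) * sqrt (8 * L) \<le> c"
      using assms(5) unfolding powr L_def N_def by linarith
    then have "(1 + real k ^ 2 * s / sqrt n * sqrt (8 * L)) * N \<le> c" by (simp add: algebra_simps)
    then have "1 + real k ^ 2 * s / sqrt n * sqrt (8 * L) \<le> c / N"
      using N by (simp add: pos_le_divide_eq)
    then show ?thesis unfolding x_def by (rule half)
  qed
  have x2: "4 * real k * L < x"
  proof -
    have "N + 8 * real k * N * L \<le> c" using assms(5) unfolding L_def N_def by linarith
    then have "(1 + 8 * real k * L) * N \<le> c" by (simp add: algebra_simps)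
    then have "1 + 8 * real k * L \<le> c / N" using N by (simp add: pos_le_divide_eq)
    then show ?thesis using half[of "8 * real k * L" "c / N"] by (simp add: x_def)
  qed
  have large: "real i - 1 + 2 * x < card (F i) / real n ^ (k - 1)" if "i \<in> {1..s}" for i
  proof -
    have "(real i - 1 + c / N) * N = (real i - 1) * N + c" using N by (simp add: distrib_right)
    then have "(real i - 1 + c / N) * N < card (F i)" using cardF[OF that] by (simp only: N_def)
    then have "real i - 1 + c / N < card (F i) / N" using N by (simp add: pos_less_divide_eq)
    then show ?thesis by (simp add: x_def N_def)
  qed
  obtain \<sigma> where \<sigma>: "\<forall>l\<in>{1..k}. \<sigma> l permutes {1..n}"
    and usable: "\<forall>i\<in>{1..s}.
      card (light_part n k (F i) ((k - 1) * (s - 1) * n ^ (k - 2)))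
        \<le> k * (s - 1) * ((k - 1) * (s - 1) * n ^ (k - 2)) \<longrightarrow>
      i \<le> card (usable n k \<sigma> (F i) ((k - 1) * (s - 1) * n ^ (k - 2)))"
    by (rule exists_permutations_with_many_usable_rows[OF assms(1-3) x1[unfolded L_def]
          x2[unfolded L_def] F large])
  show "\<exists>T. (\<forall>i\<in>{1..s}. T i \<in> F i) \<and> pairwise (\<lambda>i j. disjoint_tuples k (T i) (T j)) {1..s}"
    by (rule rainbow_matching_of_usable[where \<sigma> = \<sigma> and n = n]) (use F \<sigma> usable assms(4) in auto)
qed

end
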